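(* Let $\mathcal{A}=\mathbb{C}\text{-}\mathrm{span}\{\mathsf{e}_\alpha\}_{\alpha\in I}$ be a complex algebra with vector space basis $\{\mathsf{e}_\alpha\}_{\alpha\in I}$ indexed by a countably infinite set $I$. Let $\Omega$ be a family of linear functionals on $\mathcal{A}$ and assume $\mathcal{A}_{\Omega\text{-nice}}=\mathcal{A}$. Endow $\mathcal{A}$ with the $\Omega$-nice topology. Then: (i) The completion $\widehat{\mathcal{A}}$ of $\mathcal{A}$ is a complete locally convex algebra, which is Fréchet if $\Omega$ is countable. The underlying locally convex space is explicitly $$\widehat{\mathcal{A}}=\Big\{a\in\prod_{\alpha\in I}\mathbb{C}\mathsf{e}_\alpha\;\Big|\;\|a\|_{m,\ell,\gamma},\ \|a\|_{m,\ell,\omega}<+\infty\text{ for all }m\in\mathbb{N}_0,\ \ell=0,\dots,2^m-1,\ \gamma\in I,\ \omega\in\Omega\Big\},$$ viewed as a subspace of $\prod_{\alpha\in I}\mathbb{C}\mathsf{e}_\alpha$. (ii) The coefficient functionals $e^\alpha\colon a\mapsto a_\alpha$ ($\alpha\in I$) as well as the functionals $\omega\in\Omega$ extend to continuous linear functionals $\widehat{\mathcal{A}}\to\mathbb{C}$. (iii) The vectors $\{\mathsf{e}_\alpha\}_{\alpha\in I}$ form an unconditional Schauder basis of $\widehat{\mathcal{A}}$, i.e. $a=\sum_{\alpha\in I}e^\alpha(a)\,\mathsf{e}_\alpha$ converges unconditionally for all $a\in\widehat{\mathcal{A}}$. (iv) If $\Omega'\subseteq\Omega$, then $\mathcal{A}_{\Omega'\text{-nice}}=\mathcal{A}$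 too, and the $\Omega$-nice topology is finer than the $\Omega'$-nice topology.
   Context: An algebra here is a complex vector space with a bilinear product $\star$ (associativity is not needed). Structure constants $C^\gamma_{\alpha\beta}$ are defined by $\mathsf{e}_\alpha\star\mathsf{e}_\beta=\sum_{\gamma\in I}C^\gamma_{\alpha\beta}\mathsf{e}_\gamma$. For a formal series $a=\sum_\alpha a_\alpha\mathsf{e}_\alpha\in\prod_{\alpha\in I}\mathbb{C}\mathsf{e}_\alpha$ (in particular for $a\in\mathcal{A}$) define recursively, with values in $[0,+\infty]$ and $0\cdot\infty=0$, for $m\in\mathbb{N}_0$, $\ell=0,\dots,2^m-1$, $\gamma\in I$: $$h_{0,0,\gamma}(a)=|a_\gamma|,\qquad h_{m+1,2\ell,\gamma}(a)=\sum_{\alpha\in I}\big(h_{m,\ell,\alpha}(a)\big)^2\sum_{\beta\in I}|C^\gamma_{\alpha\beta}|,\qquad h_{m+1,2\ell+1,\gamma}(a)=\sum_{\beta\in I}\big(h_{m,\ell,\beta}(a)\big)^2\sum_{\alpha\in I}|C^\gamma_{\alpha\beta}|,$$ $\|a\|_{m,\ell,\gamma}=\big(h_{m,\ell,\gamma}(a)\big)^{1/2^m}$, and for a linear functional $\omega\colon\mathcal{A}\to\mathbb{C}$ with $\omega_\gamma=\omega(\mathsf{e}_\gamma)$, $$\|a\|_{m,\ell,\omega}=\Big(\sum_{\gamma\in I}|\omega_\gamma|\,h_{m,\ell,\gamma}(a)\Big)^{1/2^m}.$$ $\mathcal{A}_{\Omega\text{-nice}}$ is the set of $a\in\mathcal{A}$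 for which $\|a\|_{m,\ell,\gamma}$ and $\|a\|_{m,\ell,\omega}$ are finite for all $m,\ell,\gamma$ and all $\omega\in\Omega$; the $\Omega$-nice topology is the locally convex topology on it defined by all the seminorms $\|\cdot\|_{m,\ell,\gamma}$ and $\|\cdot\|_{m,\ell,\omega}$, $\omega\in\Omega$. A locally convex algebra is a locally convex space with a (jointly) continuous bilinear product; multiplicative convexity is not required. *)

theory Defs
  imports "HOL-Analysis.Analysis" "HOL-Library.Function_Algebras"
begin

section \<open>Locally convex spaces\<close>

text \<open>
  A topological vector space is given by a complex scalar multiplication \<open>smul\<close> on an ambient
  type and a topology \<open>T\<close>; the space itself is \<open>topspace T\<close>, a linear subspace of that type.
\<close>

definition linear_on ::
  "'v set \<Rightarrow> (complex \<Rightarrow> 'v \<Rightarrow> 'v) \<Rightarrow> (complex \<Rightarrow> 'w \<Rightarrow> 'w) \<Rightarrow>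
    ('v::ab_group_add \<Rightarrow> 'w::ab_group_add) \<Rightarrow> bool" where
  "linear_on V s1 s2 f \<longleftrightarrow>
    (\<forall>x\<in>V. \<forall>y\<in>V. f (x + y) = f x + f y) \<and> (\<forall>c. \<forall>x\<in>V. f (s1 c x) = s2 c (f x))"

definition locally_convex_space ::
  "(complex \<Rightarrow> 'v \<Rightarrow> 'v) \<Rightarrow> 'v::ab_group_add topology \<Rightarrow> bool" where
  "locally_convex_space smul T \<longleftrightarrow>
    vector_space smul \<and> module.subspace smul (topspace T) \<and>
    Hausdorff_space T \<and>
    continuous_map (prod_topology T T) T (\<lambda>(x, y). x + y) \<and>
    continuous_map (prod_topology euclidean T) T (\<lambda>(c, x). smul c x) \<and>
    (\<forall>U. openin T U \<and> 0 \<in> U \<longrightarrow>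
      (\<exists>W. openin T W \<and> 0 \<in> W \<and> W \<subseteq> U \<and>
        (\<forall>x\<in>W. \<forall>y\<in>W. \<forall>t\<in>{0..1::real}.
          smul (of_real (1 - t)) x + smul (of_real t) y \<in> W)))"

definition cauchy_filter_in :: "'v::ab_group_add topology \<Rightarrow> 'v filter \<Rightarrow> bool" where
  "cauchy_filter_in T F \<longleftrightarrow>
    F \<noteq> bot \<and> F \<le> principal (topspace T) \<and>
    (\<forall>U. openin T U \<and> 0 \<in> U \<longrightarrow>
      (\<exists>M. eventually (\<lambda>x. x \<in> M) F \<and> (\<forall>x\<in>M. \<forall>y\<in>M. x - y \<in> U)))"

definition complete_lcs ::
  "(complex \<Rightarrow> 'v \<Rightarrow> 'v) \<Rightarrow> 'v::ab_group_add topology \<Rightarrow> bool" where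
  "complete_lcs smul T \<longleftrightarrow>
    locally_convex_space smul T \<and>
    (\<forall>F. cauchy_filter_in T F \<longrightarrow> (\<exists>l. limitin T (\<lambda>x. x) l F))"

definition frechet_space ::
  "(complex \<Rightarrow> 'v \<Rightarrow> 'v) \<Rightarrow> 'v::ab_group_add topology \<Rightarrow> bool" where
  "frechet_space smul T \<longleftrightarrow> complete_lcs smul T \<and> metrizable_space T"

definition locally_convex_algebra ::
  "(complex \<Rightarrow> 'v \<Rightarrow> 'v) \<Rightarrow> 'v::ab_group_add topology \<Rightarrow> ('v \<Rightarrow> 'v \<Rightarrow> 'v) \<Rightarrow> bool" where
  "locally_convex_algebra smul T prd \<longleftrightarrow>
    locally_convex_space smul T \<and>
    (\<forall>x\<in>topspace T. linear_on (topspace T) smul smul (\<lambda>y. prd x y)) \<and>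
    (\<forall>y\<in>topspace T. linear_on (topspace T) smul smul (\<lambda>x. prd x y)) \<and>
    continuous_map (prod_topology T T) T (\<lambda>(x, y). prd x y)"

definition is_completion ::
  "(complex \<Rightarrow> 'v \<Rightarrow> 'v) \<Rightarrow> 'v::ab_group_add topology \<Rightarrow>
    (complex \<Rightarrow> 'w \<Rightarrow> 'w) \<Rightarrow> 'w::ab_group_add topology \<Rightarrow> ('v \<Rightarrow> 'w) \<Rightarrow> bool" where
  "is_completion s1 T1 s2 T2 j \<longleftrightarrow>
    locally_convex_space s1 T1 \<and> complete_lcs s2 T2 \<and>
    linear_on (topspace T1) s1 s2 j \<and> embedding_map T1 T2 j \<and>
    T2 closure_of (j ` topspace T1) = topspace T2"

definition continuous_linear_functional ::
  "(complex \<Rightarrow> 'v \<Rightarrow> 'v) \<Rightarrow> 'v::ab_group_add topology \<Rightarrow> ('v \<Rightarrow> complex) \<Rightarrow> bool" where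
  "continuous_linear_functional smul T f \<longleftrightarrow>
    linear_on (topspace T) smul (*) f \<and> continuous_map T euclidean f"

text \<open>
  Unconditional convergence is convergence of the net of finite partial sums, as in
  \<^const>\<open>has_sum\<close>, but with respect to an explicit topology.
\<close>

definition sums_unconditionally_in ::
  "'v::ab_group_add topology \<Rightarrow> ('i \<Rightarrow> 'v) \<Rightarrow> 'v \<Rightarrow> bool" where
  "sums_unconditionally_in T f s \<longleftrightarrow> limitin T (\<lambda>F. sum f F) s (finite_subsets_at_top UNIV)"

text \<open>
  The family \<open>b\<close> is an unconditional Schauder basis with continuous coefficient functionals \<open>c\<close>.
\<close>

definition unconditional_schauder_basis ::
  "(complex \<Rightarrow> 'v \<Rightarrow> 'v) \<Rightarrow> 'v::ab_group_add topology \<Rightarrow> ('i \<Rightarrow> 'v) \<Rightarrow>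
    ('i \<Rightarrow> 'v \<Rightarrow> complex) \<Rightarrow> bool" where
  "unconditional_schauder_basis smul T b c \<longleftrightarrow>
    (\<forall>i. b i \<in> topspace T) \<and>
    (\<forall>i. continuous_linear_functional smul T (c i)) \<and>
    (\<forall>a\<in>topspace T. sums_unconditionally_in T (\<lambda>i. smul (c i a) (b i)) a) \<and>
    (\<forall>a\<in>topspace T. \<forall>d. sums_unconditionally_in T (\<lambda>i. smul (d i) (b i)) a \<longrightarrow>
      (\<forall>i. d i = c i a))"

text \<open>
  The topology on \<open>V\<close> defined by a set \<open>P\<close> of seminorms, with all open balls of the individual
  seminorms as a subbase.
\<close>

definition seminorm_topology :: "'v::ab_group_add set \<Rightarrow> ('v \<Rightarrow> real) set \<Rightarrow> 'v topology" where
  "seminorm_topology V P =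
    topology_generated_by (insert V {{y \<in> V. p (y - x) < r} | p x r. p \<in> P \<and> x \<in> V \<and> r > 0})"

section \<open>Algebras with a basis\<close>

definition vector_space_basis ::
  "(complex \<Rightarrow> 'a \<Rightarrow> 'a::ab_group_add) \<Rightarrow> ('i \<Rightarrow> 'a) \<Rightarrow> bool" where
  "vector_space_basis smul e \<longleftrightarrow>
    inj e \<and> \<not> module.dependent smul (range e) \<and> module.span smul (range e) = UNIV"

definition bilinear_product ::
  "(complex \<Rightarrow> 'a \<Rightarrow> 'a) \<Rightarrow> ('a \<Rightarrow> 'a \<Rightarrow> 'a::ab_group_add) \<Rightarrow> bool" where
  "bilinear_product smul prd \<longleftrightarrow>
    (\<forall>x. Vector_Spaces.linear smul smul (\<lambda>y. prd x y)) \<and>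
    (\<forall>y. Vector_Spaces.linear smul smul (\<lambda>x. prd x y))"

definition coords ::
  "(complex \<Rightarrow> 'a \<Rightarrow> 'a) \<Rightarrow> ('i \<Rightarrow> 'a) \<Rightarrow> 'a::ab_group_add \<Rightarrow> ('i \<Rightarrow> complex)" where
  "coords smul e x = (\<lambda>\<alpha>. module.representation smul (range e) x (e \<alpha>))"

text \<open>\<open>struct_const smul prd e \<gamma> \<alpha> \<beta>\<close> is \<open>C\<^sup>\<gamma>\<close> with lower indices \<open>\<alpha>\<close>, \<open>\<beta>\<close>.\<close>

definition struct_const ::
  "(complex \<Rightarrow> 'a \<Rightarrow> 'a) \<Rightarrow> ('a \<Rightarrow> 'a \<Rightarrow> 'a) \<Rightarrow> ('i \<Rightarrow> 'a::ab_group_add) \<Rightarrow>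
    'i \<Rightarrow> 'i \<Rightarrow> 'i \<Rightarrow> complex" where
  "struct_const smul prd e \<gamma> \<alpha> \<beta> = coords smul e (prd (e \<alpha>) (e \<beta>)) \<gamma>"

section \<open>Nice seminorms\<close>

text \<open>
  A formal series is its coefficient family \<open>a :: 'i \<Rightarrow> complex\<close>. Everything below depends on the
  algebra only through its structure constants \<open>C\<close>, and on a functional only through its values
  \<open>w\<close> on the basis vectors.
\<close>

definition series_scale :: "complex \<Rightarrow> ('i \<Rightarrow> complex) \<Rightarrow> ('i \<Rightarrow> complex)" where
  "series_scale c a = (\<lambda>i. c * a i)"

definition basis_series :: "'i \<Rightarrow> ('i \<Rightarrow> complex)" where
  "basis_series \<alpha> = (\<lambda>\<beta>. if \<beta> = \<alpha> then 1 else 0)"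

text \<open>The second index of \<open>hnice C m l\<close> is meaningful only for \<open>l < 2 ^ m\<close>.\<close>

fun hnice ::
  "('i \<Rightarrow> 'i \<Rightarrow> 'i \<Rightarrow> complex) \<Rightarrow> nat \<Rightarrow> nat \<Rightarrow> 'i \<Rightarrow> ('i \<Rightarrow> complex) \<Rightarrow> ennreal" where
  "hnice C 0 l \<gamma> a = ennreal (cmod (a \<gamma>))"
| "hnice C (Suc m) l \<gamma> a =
    (if even l
     then \<Sum>\<^sub>\<infinity>\<alpha>\<in>UNIV. (hnice C m (l div 2) \<alpha> a)\<^sup>2 * (\<Sum>\<^sub>\<infinity>\<beta>\<in>UNIV. ennreal (cmod (C \<gamma> \<alpha> \<beta>)))
     else \<Sum>\<^sub>\<infinity>\<beta>\<in>UNIV. (hnice C m (l div 2) \<beta> a)\<^sup>2 * (\<Sum>\<^sub>\<infinity>\<alpha>\<in>UNIV. ennreal (cmod (C \<gamma> \<alpha> \<beta>))))"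

definition ennroot :: "nat \<Rightarrow> ennreal \<Rightarrow> ennreal" where
  "ennroot n x = (if x = top then top else ennreal (root n (enn2real x)))"

definition nice_norm ::
  "('i \<Rightarrow> 'i \<Rightarrow> 'i \<Rightarrow> complex) \<Rightarrow> nat \<Rightarrow> nat \<Rightarrow> 'i \<Rightarrow> ('i \<Rightarrow> complex) \<Rightarrow> ennreal" where
  "nice_norm C m l \<gamma> a = ennroot (2 ^ m) (hnice C m l \<gamma> a)"

definition nice_norm_fun ::
  "('i \<Rightarrow> 'i \<Rightarrow> 'i \<Rightarrow> complex) \<Rightarrow> nat \<Rightarrow> nat \<Rightarrow> ('i \<Rightarrow> complex) \<Rightarrow> ('i \<Rightarrow> complex) \<Rightarrow> ennreal" where
  "nice_norm_fun C m l w a =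
    ennroot (2 ^ m) (\<Sum>\<^sub>\<infinity>\<gamma>\<in>UNIV. ennreal (cmod (w \<gamma>)) * hnice C m l \<gamma> a)"

definition nice_norms ::
  "('i \<Rightarrow> 'i \<Rightarrow> 'i \<Rightarrow> complex) \<Rightarrow> ('i \<Rightarrow> complex) set \<Rightarrow> (('i \<Rightarrow> complex) \<Rightarrow> ennreal) set" where
  "nice_norms C W =
    {nice_norm C m l \<gamma> | m l \<gamma>. l < 2 ^ m} \<union> {nice_norm_fun C m l w | m l w. l < 2 ^ m \<and> w \<in> W}"

definition nice_series ::
  "('i \<Rightarrow> 'i \<Rightarrow> 'i \<Rightarrow> complex) \<Rightarrow> ('i \<Rightarrow> complex) set \<Rightarrow> ('i \<Rightarrow> complex) set" where
  "nice_series C W = {a. \<forall>p\<in>nice_norms C W. p a < top}"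

definition nice_series_topology ::
  "('i \<Rightarrow> 'i \<Rightarrow> 'i \<Rightarrow> complex) \<Rightarrow> ('i \<Rightarrow> complex) set \<Rightarrow> ('i \<Rightarrow> complex) topology" where
  "nice_series_topology C W =
    seminorm_topology (nice_series C W) ((\<lambda>p a. enn2real (p a)) ` nice_norms C W)"

definition functional_coeffs ::
  "('i \<Rightarrow> 'a) \<Rightarrow> ('a \<Rightarrow> complex) set \<Rightarrow> ('i \<Rightarrow> complex) set" where
  "functional_coeffs e \<Omega> = (\<lambda>\<omega> \<gamma>. \<omega> (e \<gamma>)) ` \<Omega>"

definition nice_part ::
  "(complex \<Rightarrow> 'a \<Rightarrow> 'a) \<Rightarrow> ('a \<Rightarrow> 'a \<Rightarrow> 'a) \<Rightarrow> ('i \<Rightarrow> 'a::ab_group_add) \<Rightarrow>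
    ('a \<Rightarrow> complex) set \<Rightarrow> 'a set" where
  "nice_part smul prd e \<Omega> =
    {x. \<forall>p\<in>nice_norms (struct_const smul prd e) (functional_coeffs e \<Omega>).
          p (coords smul e x) < top}"

definition nice_topology ::
  "(complex \<Rightarrow> 'a \<Rightarrow> 'a) \<Rightarrow> ('a \<Rightarrow> 'a \<Rightarrow> 'a) \<Rightarrow> ('i \<Rightarrow> 'a::ab_group_add) \<Rightarrow>
    ('a \<Rightarrow> complex) set \<Rightarrow> 'a topology" where
  "nice_topology smul prd e \<Omega> =
    seminorm_topology (nice_part smul prd e \<Omega>)
      ((\<lambda>p x. enn2real (p (coords smul e x))) `
        nice_norms (struct_const smul prd e) (functional_coeffs e \<Omega>))"

definition completed_space ::
  "(complex \<Rightarrow> 'a \<Rightarrow> 'a) \<Rightarrow> ('a \<Rightarrow> 'a \<Rightarrow> 'a) \<Rightarrow> ('i \<Rightarrow> 'a::ab_group_add) \<Rightarrow>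
    ('a \<Rightarrow> complex) set \<Rightarrow> ('i \<Rightarrow> complex) set" where
  "completed_space smul prd e \<Omega> =
    nice_series (struct_const smul prd e) (functional_coeffs e \<Omega>)"

definition completed_topology ::
  "(complex \<Rightarrow> 'a \<Rightarrow> 'a) \<Rightarrow> ('a \<Rightarrow> 'a \<Rightarrow> 'a) \<Rightarrow> ('i \<Rightarrow> 'a::ab_group_add) \<Rightarrow>
    ('a \<Rightarrow> complex) set \<Rightarrow> ('i \<Rightarrow> complex) topology" where
  "completed_topology smul prd e \<Omega> =
    nice_series_topology (struct_const smul prd e) (functional_coeffs e \<Omega>)"

end

theory Submission
  imports Defs
begin

text \<open>
  Every \<open>h\<^sub>m\<^sub>,\<^sub>l\<^sub>,\<^sub>\<gamma>\<close> arises from the absolute values of the coefficients by alternately squaring and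
  forming sums with weights in \<open>[0, \<infinity>]\<close>. Five properties are inherited along this recursion and are
  collected in the locale \<open>seminorm_power\<close>: absolute homogeneity (of degree \<open>2\<^sup>m\<close>), convexity,
  monotonicity in the absolute values of the coefficients, lower semicontinuity for coefficientwise
  convergence, and, wherever the functional is finite, convergence to zero on the tails of a series.
  They carry the analytic part of the result:

  \<^item> A convex functional that is homogeneous of degree \<open>n\<close> has a subadditive \<open>n\<close>-th root, so the nice
    norms are seminorms (\<open>ennroot_triangle\<close>) and define a locally convex space.

  \<^item> The limit of a Cauchy filter exists coefficientwise, and by lower semicontinuity the nice norms
    control the distance to it (\<open>complete_nice_series\<close>). With countably many seminorms the space is
    also metrizable, hence Frechet.

  \<^item> The difference between a series and one of its finite parts is a tail. Hence the finite parts
    converge (\<open>nice_series_expansion\<close>): the basis vectors form an unconditional Schauder basis, and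
    the algebra, which consists of the finite series, is dense in the space of all nice series. As
    its topology is the one induced from there, the latter space is its completion.

  The product extends because its functionals of level \<open>m\<close> are bounded by those of the factors of
  level \<open>m + 1\<close>:
  \<open>2 h\<^sub>m\<^sub>,\<^sub>l\<^sub>,\<^sub>\<gamma>(a \<star> b) \<le> h\<^sub>m\<^sub>+\<^sub>1\<^sub>,\<^sub>l\<^sub>,\<^sub>\<gamma>(a) + h\<^sub>m\<^sub>+\<^sub>1\<^sub>,\<^sub>k\<^sub>,\<^sub>\<gamma>(b)\<close> with \<open>k = l + 2\<^sup>m\<close>
  (\<open>hnice_series_product_le\<close>). For \<open>m = 0\<close> this is \<open>2xy \<le> x\<^sup>2 + y\<^sup>2\<close> applied to each term of the
  double series, and convexity of the square passes it on from \<open>m\<close> to \<open>m + 1\<close>. Since the right-hand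
  side has twice the degree of the left-hand side, rescaling \<open>a\<close> and \<open>b\<close> turns the sum into the
  product \<open>\<parallel>a\<parallel>\<^sub>m\<^sub>+\<^sub>1\<^sub>,\<^sub>l\<^sub>,\<^sub>\<gamma> \<parallel>b\<parallel>\<^sub>m\<^sub>+\<^sub>1\<^sub>,\<^sub>k\<^sub>,\<^sub>\<gamma>\<close>, which means joint continuity.
\<close>

section \<open>Spaces topologised by a family of seminorms\<close>

lemma ex_small_factor:
  fixes D r :: real
  assumes "D > 0" "r > 0"
  obtains \<delta> where "0 < \<delta>" "\<delta> \<le> 1" "\<delta> * D \<le> r"
proof
  show "min 1 (r / D) * D \<le> r"
    using mult_right_mono[of "min 1 (r / D)" "r / D" D] assms by simp
qed (use assms in auto)

locale seminormed_space = vector_space smul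
  for smul :: "complex \<Rightarrow> 'v::ab_group_add \<Rightarrow> 'v" +
  fixes V :: "'v set" and P :: "('v \<Rightarrow> real) set"
  assumes subspace_V: "subspace V"
    and triangle: "\<lbrakk>p \<in> P; x \<in> V; y \<in> V\<rbrakk> \<Longrightarrow> p (x + y) \<le> p x + p y"
    and homogeneous: "\<lbrakk>p \<in> P; x \<in> V\<rbrakk> \<Longrightarrow> p (smul c x) = cmod c * p x"
    and separating: "\<lbrakk>x \<in> V; \<And>p. p \<in> P \<Longrightarrow> p x = 0\<rbrakk> \<Longrightarrow> x = 0"
begin

lemma V_closed [simp, intro]:
  "0 \<in> V" "x \<in> V \<Longrightarrow> y \<in> V \<Longrightarrow> x + y \<in> V" "x \<in> V \<Longrightarrow> smul c x \<in> V"
  "x \<in> V \<Longrightarrow> y \<in> V \<Longrightarrow> x - y \<in> V"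
  using subspace_V by (auto simp: subspace_0 subspace_add subspace_scale subspace_diff)

lemma seminorm_zero [simp]: "p \<in> P \<Longrightarrow> p 0 = 0"
  using homogeneous[of p 0 0] by simp

lemma seminorm_minus: "p \<in> P \<Longrightarrow> x \<in> V \<Longrightarrow> p (- x) = p x"
  using homogeneous[of p x "-1"] by simp

lemma seminorm_nonneg: "p \<in> P \<Longrightarrow> x \<in> V \<Longrightarrow> 0 \<le> p x"
  using triangle[of p x "-x"] seminorm_minus[of p x] V_closed(4)[of 0 x] by simp

lemma seminorm_diff_commute: "p \<in> P \<Longrightarrow> x \<in> V \<Longrightarrow> y \<in> V \<Longrightarrow> p (x - y) = p (y - x)"
  using seminorm_minus[of p "x - y"] by simp

lemma triangle_diff:
  "\<lbrakk>p \<in> P; x \<in> V; y \<in> V; z \<in> V\<rbrakk> \<Longrightarrow> p (x - z) \<le> p (x - y) + p (y - z)"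
  using triangle[of p "x - y" "y - z"] by simp

definition box :: "('v \<Rightarrow> real) set \<Rightarrow> real \<Rightarrow> 'v \<Rightarrow> 'v set" where
  "box F r x = {y \<in> V. \<forall>p\<in>F. p (y - x) < r}"

lemma topspace_seminorm_topology [simp]: "topspace (seminorm_topology V P) = V"
  by (auto simp: seminorm_topology_def)

lemma openin_box:
  assumes "finite F" "F \<subseteq> P" "x \<in> V" "r > 0"
  shows "openin (seminorm_topology V P) (box F r x)"
proof -
  have "box F r x = \<Inter>(insert V ((\<lambda>p. {y \<in> V. p (y - x) < r}) ` F))"
    by (auto simp: box_def)
  moreover have "openin (seminorm_topology V P) {y \<in> V. p (y - x) < r}" if "p \<in> F" for p
    unfolding seminorm_topology_def using that assms
    by (intro topology_generated_by_Basis) blast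
  ultimately show ?thesis
    using openin_topspace[of "seminorm_topology V P"] \<open>finite F\<close>
    by (simp only: topspace_seminorm_topology) (rule openin_Inter, auto)
qed

lemma centre_in_box: "F \<subseteq> P \<Longrightarrow> x \<in> V \<Longrightarrow> r > 0 \<Longrightarrow> x \<in> box F r x"
  by (auto simp: box_def)

text \<open>
  The subbase consists of balls with arbitrary centres. By the triangle inequality each of them
  contains a ball around any of its points, so finite intersections of balls with a common centre
  already form neighbourhood bases.
\<close>

lemma openin_seminorm_topology:
  "openin (seminorm_topology V P) U \<longleftrightarrow>
    U \<subseteq> V \<and> (\<forall>x\<in>U. \<exists>F r. finite F \<and> F \<subseteq> P \<and> r > 0 \<and> box F r x \<subseteq> U)"
    (is "?open \<longleftrightarrow> ?nbhd U")
proof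
  assume ?open
  then have "generate_topology_on
      (insert V {{y \<in> V. p (y - x) < r} | p x r. p \<in> P \<and> x \<in> V \<and> r > 0}) U"
    by (simp add: seminorm_topology_def openin_topology_generated_by_iff)
  then show "?nbhd U"
  proof induction
    case Empty
    then show ?case by simp
  next
    case (Int A B)
    show ?case
    proof (intro conjI ballI)
      show "A \<inter> B \<subseteq> V" using Int by auto
      fix x assume "x \<in> A \<inter> B"
      then obtain F r G s where "finite F" "F \<subseteq> P" "r > 0" "box F r x \<subseteq> A"
        and "finite G" "G \<subseteq> P" "s > 0" "box G s x \<subseteq> B"
        using Int.IH by (meson IntD1 IntD2)
      then show "\<exists>F r. finite F \<and> F \<subseteq> P \<and> r > 0 \<and> box F r x \<subseteq> A \<inter> B"
        by (intro exI[of _ "F \<union> G"] exI[of _ "min r s"]) (auto simp: box_def)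
    qed
  next
    case (UN K)
    show ?case
    proof (intro conjI ballI)
      show "\<Union>K \<subseteq> V" using UN.IH by auto
      fix x assume "x \<in> \<Union>K"
      then obtain A where "A \<in> K" "x \<in> A" by auto
      then obtain F r where "finite F" "F \<subseteq> P" "r > 0" "box F r x \<subseteq> A"
        using UN.IH by meson
      then show "\<exists>F r. finite F \<and> F \<subseteq> P \<and> r > 0 \<and> box F r x \<subseteq> \<Union>K"
        using \<open>A \<in> K\<close> by blast
    qed
  next
    case (Basis A)
    then consider "A = V" | p z r where "A = {y \<in> V. p (y - z) < r}" "p \<in> P" "z \<in> V" "r > 0"
      by blast
    then show ?case
    proof cases
      case 1
      then show ?thesis
        by (intro conjI ballI exI[of _ "{}"] exI[of _ 1]) (auto simp: box_def)
    next
      case 2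
      show ?thesis
      proof (intro conjI ballI)
        show "A \<subseteq> V" using 2 by auto
        fix x assume x: "x \<in> A"
        have "p (y - z) < r" if "y \<in> V" "p (y - x) < r - p (x - z)" for y
          using triangle_diff[of p y x z] 2 x that by auto
        then have "box {p} (r - p (x - z)) x \<subseteq> A"
          using 2 by (auto simp: box_def)
        then show "\<exists>F r. finite F \<and> F \<subseteq> P \<and> r > 0 \<and> box F r x \<subseteq> A"
          using 2 x by (intro exI[of _ "{p}"] exI[of _ "r - p (x - z)"]) auto
      qed
    qed
  qed
next
  assume U: "?nbhd U"
  have "\<exists>W. openin (seminorm_topology V P) W \<and> x \<in> W \<and> W \<subseteq> U" if x: "x \<in> U" for x
  proof -
    obtain F r where "finite F" "F \<subseteq> P" "r > 0" "box F r x \<subseteq> U"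
      using U x by meson
    then show ?thesis
      using openin_box[of F x r] centre_in_box[of F x r] x U by blast
  qed
  then show ?open
    by (subst openin_subopen) blast
qed

text \<open>
  Convergence has to be tested one seminorm at a time only, because a basic neighbourhood involves
  finitely many seminorms. The same reduction underlies the criterion for continuous maps below.
\<close>

lemma limitin_seminorm_topology:
  "limitin (seminorm_topology V P) f l G \<longleftrightarrow>
    l \<in> V \<and> eventually (\<lambda>i. f i \<in> V) G \<and>
    (\<forall>p\<in>P. \<forall>r>0. eventually (\<lambda>i. p (f i - l) < r) G)" (is "?lim \<longleftrightarrow> ?ev")
proof
  assume lim: ?lim
  then have "l \<in> V" by (auto simp: limitin_def)
  moreover have "eventually (\<lambda>i. f i \<in> V) G"
    using lim \<open>l \<in> V\<close> openin_topspace[of "seminorm_topology V P"]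
    by (auto simp: limitin_def simp del: openin_topspace)
  moreover have "eventually (\<lambda>i. p (f i - l) < r) G" if "p \<in> P" "r > 0" for p r
  proof -
    have "eventually (\<lambda>i. f i \<in> box {p} r l) G"
      using lim openin_box[of "{p}" l r] centre_in_box[of "{p}" l r] that \<open>l \<in> V\<close>
      by (auto simp: limitin_def)
    then show ?thesis by eventually_elim (auto simp: box_def)
  qed
  ultimately show ?ev by blast
next
  assume ev: ?ev
  have "eventually (\<lambda>i. f i \<in> U) G" if U: "openin (seminorm_topology V P) U" "l \<in> U" for U
  proof -
    obtain F r where F: "finite F" "F \<subseteq> P" "r > 0" "box F r l \<subseteq> U"
      using U by (meson openin_seminorm_topology)
    have "eventually (\<lambda>i. \<forall>p\<in>F. p (f i - l) < r) G"
      using F ev by (auto intro!: eventually_ball_finite)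
    with ev have "eventually (\<lambda>i. f i \<in> V \<and> (\<forall>p\<in>F. p (f i - l) < r)) G"
      by (simp add: eventually_conj_iff)
    then show ?thesis
      by eventually_elim (use F in \<open>auto simp: box_def\<close>)
  qed
  then show ?lim using ev by (auto simp: limitin_def)
qed

lemma continuous_map_seminorm_topologyI:
  assumes "f \<in> topspace X \<rightarrow> V"
    and "\<And>x p r. \<lbrakk>x \<in> topspace X; p \<in> P; r > 0\<rbrakk> \<Longrightarrow>
      \<exists>W. openin X W \<and> x \<in> W \<and> (\<forall>y\<in>W. p (f y - f x) < r)"
  shows "continuous_map X (seminorm_topology V P) f"
  unfolding continuous_map_def
proof (intro conjI allI impI)
  show "f \<in> topspace X \<rightarrow> topspace (seminorm_topology V P)"
    using assms(1) by simp
  fix U assume U: "openin (seminorm_topology V P) U"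
  have "\<exists>W. openin X W \<and> x \<in> W \<and> W \<subseteq> {x \<in> topspace X. f x \<in> U}"
    if x: "x \<in> topspace X" "f x \<in> U" for x
  proof -
    obtain F r where F: "finite F" "F \<subseteq> P" "r > 0" "box F r (f x) \<subseteq> U"
      using U x by (meson openin_seminorm_topology)
    obtain W where W: "\<And>p. p \<in> F \<Longrightarrow> openin X (W p) \<and> x \<in> W p \<and> (\<forall>y\<in>W p. p (f y - f x) < r)"
      using assms(2)[OF x(1) _ \<open>r > 0\<close>] F(2) by (metis subsetD)
    let ?W = "\<Inter>(insert (topspace X) (W ` F))"
    have "openin X ?W"
      using W F(1) by (intro openin_Inter) auto
    moreover have "?W \<subseteq> {x \<in> topspace X. f x \<in> U}"
      using W F(4) assms(1) by (fastforce simp: box_def)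
    ultimately show ?thesis
      using W x(1) by (intro exI[of _ ?W]) auto
  qed
  then show "openin X {x \<in> topspace X. f x \<in> U}"
    by (subst openin_subopen) blast
qed

lemma openin_ball:
  assumes "p \<in> P" "x \<in> V" "r > 0"
  shows "openin (seminorm_topology V P) {y \<in> V. p (y - x) < r}"
  using openin_box[of "{p}" x r] assms by (simp add: box_def)

lemma continuous_map_add:
  "continuous_map (prod_topology (seminorm_topology V P) (seminorm_topology V P))
    (seminorm_topology V P) (\<lambda>(x, y). x + y)"
proof (rule continuous_map_seminorm_topologyI; clarsimp)
  fix a b p and r :: real
  assume ab: "a \<in> V" "b \<in> V" "p \<in> P" "0 < r"
  let ?B = "\<lambda>x. {y \<in> V. p (y - x) < r / 2}"
  have "p (x + y - (a + b)) < r" if "x \<in> ?B a" "y \<in> ?B b" for x y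
    using triangle[of p "x - a" "y - b"] that ab by (simp add: algebra_simps)
  moreover have "openin (prod_topology (seminorm_topology V P) (seminorm_topology V P))
      (?B a \<times> ?B b)"
    using ab openin_ball[of p a "r / 2"] openin_ball[of p b "r / 2"]
    by (simp add: openin_prod_Times_iff)
  ultimately show "\<exists>W. openin (prod_topology (seminorm_topology V P) (seminorm_topology V P)) W \<and>
      (a, b) \<in> W \<and> (\<forall>z\<in>W. p ((case z of (x, y) \<Rightarrow> x + y) - (a + b)) < r)"
    using ab by (intro exI[of _ "?B a \<times> ?B b"]) auto
qed

lemma continuous_map_scale:
  "continuous_map (prod_topology euclidean (seminorm_topology V P))
    (seminorm_topology V P) (\<lambda>(c, x). smul c x)"
proof (rule continuous_map_seminorm_topologyI; clarsimp)
  fix c :: complex and a p and r :: real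
  assume a: "a \<in> V" "p \<in> P" "0 < r"
  have pos: "p a \<ge> 0" using seminorm_nonneg a by auto
  have D: "p a + cmod c + 2 > 0" using pos norm_ge_zero[of c] by linarith
  \<comment> \<open>\<open>\<delta>\<close> makes \<open>(\<bar>c\<bar> + 1) \<delta> + \<delta> p(a)\<close> smaller than \<open>r\<close>.\<close>
  obtain \<delta> where \<delta>: "0 < \<delta>" "\<delta> \<le> 1" "\<delta> * (p a + cmod c + 2) \<le> r"
    using ex_small_factor[OF D a(3)] .
  let ?W = "ball c \<delta> \<times> {y \<in> V. p (y - a) < \<delta>}"
  have "p (smul d x - smul c a) < r" if x: "d \<in> ball c \<delta>" "x \<in> V" "p (x - a) < \<delta>" for d x
  proof -
    have dc: "cmod (d - c) < \<delta>" using x(1) by (simp add: dist_norm norm_minus_commute)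
    have "cmod d \<le> cmod c + 1"
      using norm_triangle_ineq[of c "d - c"] dc \<delta> by simp
    have "smul d x - smul c a = smul d (x - a) + smul (d - c) a"
      by (simp add: scale_right_diff_distrib scale_left_diff_distrib)
    then have "p (smul d x - smul c a) \<le> cmod d * p (x - a) + cmod (d - c) * p a"
      using triangle[of p "smul d (x - a)" "smul (d - c) a"] a x by (simp add: homogeneous)
    also have "\<dots> \<le> (cmod c + 1) * \<delta> + \<delta> * p a"
      using \<open>cmod d \<le> cmod c + 1\<close> x(3) dc pos seminorm_nonneg[of p "x - a"] a x
      by (intro add_mono mult_mono) auto
    also have "\<dots> < r"
      using \<delta> by (simp add: algebra_simps)
    finally show ?thesis .
  qed
  moreover have "openin (prod_topology euclidean (seminorm_topology V P)) ?W"
    using a openin_ball[of p a \<delta>] \<delta> by (simp add: openin_prod_Times_iff)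
  ultimately show "\<exists>W. openin (prod_topology euclidean (seminorm_topology V P)) W \<and>
      (c, a) \<in> W \<and> (\<forall>z\<in>W. p ((case z of (d, x) \<Rightarrow> smul d x) - smul c a) < r)"
    using a \<delta> by (intro exI[of _ ?W]) auto
qed

lemma Hausdorff_seminorm_topology: "Hausdorff_space (seminorm_topology V P)"
  unfolding Hausdorff_space_def
proof (clarsimp)
  fix x y assume xy: "x \<in> V" "y \<in> V" "x \<noteq> y"
  then obtain p where p: "p \<in> P" "p (x - y) \<noteq> 0"
    using separating[of "x - y"] by auto
  define r where "r = p (x - y) / 2"
  have r: "r > 0" using seminorm_nonneg[of p "x - y"] p xy by (simp add: r_def)
  let ?B = "\<lambda>x. {y \<in> V. p (y - x) < r}"
  have "disjnt (?B x) (?B y)"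
    unfolding disjnt_iff
  proof (intro allI notI, clarify)
    fix z assume "z \<in> V" "p (z - x) < r" "p (z - y) < r"
    then show False
      using triangle_diff[of p x z y] seminorm_diff_commute[of p x z] xy p
      by (simp add: r_def)
  qed
  then show "\<exists>U. openin (seminorm_topology V P) U \<and> (\<exists>W. openin (seminorm_topology V P) W \<and>
      x \<in> U \<and> y \<in> W \<and> disjnt U W)"
    using openin_ball[of p x r] openin_ball[of p y r] p r xy
    by (intro exI[of _ "?B x"] exI[of _ "?B y"] conjI) auto
qed

lemma convex_box:
  assumes "F \<subseteq> P" "x \<in> box F r 0" "y \<in> box F r 0" "t \<in> {0..1::real}"
  shows "smul (of_real (1 - t)) x + smul (of_real t) y \<in> box F r 0"
proof -
  have "p (smul (of_real (1 - t)) x + smul (of_real t) y) < r" if "p \<in> F" for p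
  proof -
    have "p (smul (of_real (1 - t)) x + smul (of_real t) y) \<le> (1 - t) * p x + t * p y"
      using triangle[of p "smul (of_real (1 - t)) x" "smul (of_real t) y"] that assms
      by (auto simp: homogeneous box_def subset_iff norm_of_real simp del: of_real_diff)
    also have "\<dots> < r"
      using convex_bound_lt[of "p x" r "p y" "1 - t" t] that assms by (auto simp: box_def)
    finally show ?thesis .
  qed
  then show ?thesis using assms by (auto simp: box_def)
qed

theorem locally_convex_seminorm_topology: "locally_convex_space smul (seminorm_topology V P)"
  unfolding locally_convex_space_def
proof (intro conjI allI impI)
  show "vector_space smul" by unfold_locales
  show "subspace (topspace (seminorm_topology V P))" by (simp add: subspace_V)
  fix U assume U: "openin (seminorm_topology V P) U \<and> 0 \<in> U"
  then obtain F r where F: "finite F" "F \<subseteq> P" "r > 0" "box F r 0 \<subseteq> U"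
    by (meson openin_seminorm_topology)
  then show "\<exists>W. openin (seminorm_topology V P) W \<and> 0 \<in> W \<and> W \<subseteq> U \<and>
      (\<forall>x\<in>W. \<forall>y\<in>W. \<forall>t\<in>{0..1::real}. smul (of_real (1 - t)) x + smul (of_real t) y \<in> W)"
    using openin_box[of F 0 r] centre_in_box[of F 0 r] convex_box[of F _ r]
    by (intro exI[of _ "box F r 0"]) auto
qed (use continuous_map_add continuous_map_scale Hausdorff_seminorm_topology in auto)

lemma continuous_linear_functional_seminorm_topology:
  assumes "linear_on V smul (*) f" "p \<in> P" "\<And>x. x \<in> V \<Longrightarrow> cmod (f x) \<le> p x"
  shows "continuous_linear_functional smul (seminorm_topology V P) f"
proof -
  have f_diff: "f (x - y) = f x - f y" if "x \<in> V" "y \<in> V" for x y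
  proof -
    have "f (x + smul (-1) y) = f x + f (smul (-1) y)"
      using assms(1) that unfolding linear_on_def by blast
    also have "f (smul (-1) y) = (-1) * f y"
      using assms(1) that unfolding linear_on_def by blast
    finally show ?thesis by simp
  qed
  have "openin (seminorm_topology V P) {x \<in> V. f x \<in> U}" if "open U" for U
    unfolding openin_seminorm_topology
  proof (intro conjI ballI)
    fix x assume x: "x \<in> {x \<in> V. f x \<in> U}"
    then obtain r where r: "r > 0" "ball (f x) r \<subseteq> U"
      using \<open>open U\<close> by (metis (lifting) mem_Collect_eq open_contains_ball)
    have "box {p} r x \<subseteq> {x \<in> V. f x \<in> U}"
    proof
      fix y assume y: "y \<in> box {p} r x"
      then have "cmod (f y - f x) < r"
        using assms(3)[of "y - x"] f_diff[of y x] x by (auto simp: box_def)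
      then show "y \<in> {x \<in> V. f x \<in> U}"
        using r y by (auto simp: box_def dist_norm norm_minus_commute)
    qed
    then show "\<exists>F r. finite F \<and> F \<subseteq> P \<and> 0 < r \<and> box F r x \<subseteq> {x \<in> V. f x \<in> U}"
      using r assms(2) by (intro exI[of _ "{p}"] exI[of _ r]) auto
  qed auto
  then show ?thesis
    using assms(1) by (simp add: continuous_linear_functional_def continuous_map_def)
qed

text \<open>
  Continuity at \<open>(a, b)\<close> follows from the decomposition
  \<open>B x y - B a b = B (x - a) y + B a (y - b)\<close>.
\<close>

lemma continuous_map_bilinear:
  assumes lin: "\<And>x. x \<in> V \<Longrightarrow> linear_on V smul smul (\<lambda>y. B x y)"
      "\<And>y. y \<in> V \<Longrightarrow> linear_on V smul smul (\<lambda>x. B x y)"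
    and V: "\<And>x y. x \<in> V \<Longrightarrow> y \<in> V \<Longrightarrow> B x y \<in> V"
    and bound: "\<And>p. p \<in> P \<Longrightarrow>
      \<exists>q\<in>P. \<exists>q'\<in>P. \<forall>x\<in>V. \<forall>y\<in>V. p (B x y) \<le> q x * q' y"
  shows "continuous_map (prod_topology (seminorm_topology V P) (seminorm_topology V P))
    (seminorm_topology V P) (\<lambda>(x, y). B x y)"
proof (rule continuous_map_seminorm_topologyI; clarsimp simp: V)
  fix a b p and r :: real
  assume ab: "a \<in> V" "b \<in> V" "p \<in> P" "0 < r"
  obtain q q' where q: "q \<in> P" "q' \<in> P" "\<And>x y. x \<in> V \<Longrightarrow> y \<in> V \<Longrightarrow> p (B x y) \<le> q x * q' y"
    using bound[OF ab(3)] by blast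
  have pos: "q a \<ge> 0" "q' b \<ge> 0" using seminorm_nonneg q ab by auto
  then have D: "q a + q' b + 2 > 0" by simp
  \<comment> \<open>\<open>\<delta>\<close> makes \<open>\<delta> (1 + q'(b)) + q(a) \<delta>\<close> smaller than \<open>r\<close>.\<close>
  obtain \<delta> where \<delta>: "0 < \<delta>" "\<delta> \<le> 1" "\<delta> * (q a + q' b + 2) \<le> r"
    using ex_small_factor[OF D ab(4)] .
  let ?W = "{x \<in> V. q (x - a) < \<delta>} \<times> {y \<in> V. q' (y - b) < \<delta>}"
  have "p (B x y - B a b) < r" if xy: "x \<in> V" "q (x - a) < \<delta>" "y \<in> V" "q' (y - b) < \<delta>" for x y
  proof -
    have "B ((x - a) + a) y = B (x - a) y + B a y"
      using lin(2)[of y] ab xy unfolding linear_on_def by blast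
    moreover have "B a ((y - b) + b) = B a (y - b) + B a b"
      using lin(1)[of a] ab xy unfolding linear_on_def by blast
    ultimately have "B x y - B a b = B (x - a) y + B a (y - b)"
      by simp
    then have "p (B x y - B a b) \<le> p (B (x - a) y) + p (B a (y - b))"
      using triangle[of p "B (x - a) y" "B a (y - b)"] V ab xy by simp
    also have "\<dots> \<le> q (x - a) * q' y + q a * q' (y - b)"
      using q ab xy by (intro add_mono) auto
    also have "\<dots> \<le> \<delta> * (1 + q' b) + q a * \<delta>"
      using triangle[of q' "y - b" b] \<delta> xy pos seminorm_nonneg ab q
      by (intro add_mono mult_mono) auto
    also have "\<dots> < r"
      using \<delta> by (simp add: algebra_simps)
    finally show ?thesis .
  qed
  moreover have "openin (prod_topology (seminorm_topology V P) (seminorm_topology V P)) ?W"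
    using ab q openin_ball[of q a \<delta>] openin_ball[of q' b \<delta>] \<delta> by (simp add: openin_prod_Times_iff)
  ultimately show "\<exists>W. openin (prod_topology (seminorm_topology V P) (seminorm_topology V P)) W \<and>
      (a, b) \<in> W \<and> (\<forall>z\<in>W. p ((case z of (x, y) \<Rightarrow> B x y) - B a b) < r)"
    using ab q \<delta> by (intro exI[of _ ?W]) auto
qed

text \<open>
  For seminorms \<open>p\<^sub>0, p\<^sub>1, \<dots>\<close> the metric is \<open>d x y = sup\<^sub>n min (2\<^sup>-\<^sup>n) (p\<^sub>n (x - y))\<close>: a ball of radius
  \<open>r\<close> constrains only the finitely many seminorms with \<open>2\<^sup>-\<^sup>n \<ge> r\<close>.
\<close>

theorem metrizable_seminorm_topology:
  assumes "countable P" "P \<noteq> {}"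
  shows "metrizable_space (seminorm_topology V P)"
proof -
  define p where "p = from_nat_into P"
  have p: "p n \<in> P" for n using assms by (simp add: p_def from_nat_into)
  have p_surj: "\<exists>n. p n = q" if "q \<in> P" for q
    using assms that by (metis p_def from_nat_into_surj)
  define g where "g x y n = min ((1/2)^n) \<bar>p n (x - y)\<bar>" for x y n
  define d where "d x y = (SUP n. g x y n)" for x y
  have g_nonneg: "0 \<le> g x y n" and g_le_1: "g x y n \<le> 1" for x y n
    by (auto simp: g_def min_le_iff_disj power_le_one)
  have bdd: "bdd_above (range (g x y))" for x y
    using g_le_1 by (auto intro!: bdd_aboveI[of _ 1])
  have g_le_d: "g x y n \<le> d x y" for x y n
    unfolding d_def using bdd by (intro cSUP_upper) auto
  have d_le: "d x y \<le> c" if "\<And>n. g x y n \<le> c" for x y c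
    unfolding d_def using that by (intro cSUP_least) auto
  \<comment> \<open>Outside \<open>V\<close> the seminorms are arbitrary, so the distance is set to 0 there: \<open>Metric_space\<close>
    demands symmetry on the whole type.\<close>
  interpret M: Metric_space V "\<lambda>x y. if x \<in> V \<and> y \<in> V then d x y else 0"
  proof
    fix x y z
    show "0 \<le> (if x \<in> V \<and> y \<in> V then d x y else 0)"
      using g_nonneg[of x y 0] g_le_d[of x y 0] by auto
    have "g x y = g y x" if "x \<in> V" "y \<in> V"
      using that p by (auto simp: g_def seminorm_diff_commute)
    then show "(if x \<in> V \<and> y \<in> V then d x y else 0) = (if y \<in> V \<and> x \<in> V then d y x else 0)"
      by (auto simp: d_def)
    assume xy: "x \<in> V" "y \<in> V"
    show "(if x \<in> V \<and> y \<in> V then d x y else 0) = 0 \<longleftrightarrow> x = y"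
    proof
      assume d0: "(if x \<in> V \<and> y \<in> V then d x y else 0) = 0"
      have "q (x - y) = 0" if "q \<in> P" for q
      proof -
        obtain n where "p n = q" using p_surj \<open>q \<in> P\<close> by blast
        moreover have "g x y n \<le> 0" using g_le_d[of x y n] d0 xy by simp
        moreover have "(1/2::real)^n > 0" by simp
        ultimately show ?thesis by (auto simp: g_def min_le_iff_disj)
      qed
      then show "x = y" using separating[of "x - y"] xy by auto
    next
      assume "x = y"
      then have "d x y \<le> 0" using p by (intro d_le) (simp add: g_def min_le_iff_disj)
      then show "(if x \<in> V \<and> y \<in> V then d x y else 0) = 0"
        using g_nonneg[of x y 0] g_le_d[of x y 0] by auto
    qed
    assume z: "z \<in> V"
    have "d x z \<le> d x y + d y z"
    proof (rule d_le)
      fix n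
      have "\<bar>p n (x - z)\<bar> \<le> \<bar>p n (x - y)\<bar> + \<bar>p n (y - z)\<bar>"
        using triangle_diff[OF p, of x y z n] seminorm_nonneg[OF p, of "x - z" n] xy z by auto
      then have "g x z n \<le> g x y n + g y z n"
        by (auto simp: g_def min_def)
      then show "g x z n \<le> d x y + d y z"
        using g_le_d[of x y n] g_le_d[of y z n] by linarith
    qed
    then show "(if x \<in> V \<and> z \<in> V then d x z else 0) \<le>
        (if x \<in> V \<and> y \<in> V then d x y else 0) + (if y \<in> V \<and> z \<in> V then d y z else 0)"
      using xy z by simp
  qed
  have mball: "M.mball x r = {y \<in> V. d x y < r}" if "x \<in> V" for x r
    using that by (auto simp: M.mball_def)
  have "seminorm_topology V P = M.mtopology"
    unfolding topology_eq
  proof (intro allI iffI)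
    fix U assume U: "openin (seminorm_topology V P) U"
    show "openin M.mtopology U"
      unfolding M.openin_mtopology
    proof (intro conjI allI impI)
      show UV: "U \<subseteq> V" using U by (simp add: openin_seminorm_topology)
      fix x assume "x \<in> U"
      then obtain F r where F: "finite F" "F \<subseteq> P" "r > 0" "box F r x \<subseteq> U"
        using U by (meson openin_seminorm_topology)
      have x: "x \<in> V" using \<open>x \<in> U\<close> UV by auto
      obtain i where i: "\<And>q. q \<in> F \<Longrightarrow> p (i q) = q"
        using p_surj F(2) by (metis subsetD)
      define s where "s = Min (insert r ((\<lambda>q. (1/2)^(i q)) ` F))"
      have s: "s > 0" "s \<le> r" "\<And>q. q \<in> F \<Longrightarrow> s \<le> (1/2)^(i q)"
        using F(1,3) by (auto simp: s_def)
      have "M.mball x s \<subseteq> box F r x"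
      proof
        fix y assume "y \<in> M.mball x s"
        then have y: "y \<in> V" "d x y < s" using mball[OF x] by auto
        have "q (y - x) < r" if "q \<in> F" for q
        proof -
          have "g x y (i q) < s" using g_le_d[of x y "i q"] y by linarith
          then have "\<bar>q (x - y)\<bar> < s" using s(3)[OF that] i[OF that] by (auto simp: g_def)
          moreover have "q (y - x) = q (x - y)"
            using that F(2) x y by (intro seminorm_diff_commute) auto
          ultimately show ?thesis using s by linarith
        qed
        then show "y \<in> box F r x" using y by (auto simp: box_def)
      qed
      then show "\<exists>r>0. M.mball x r \<subseteq> U" using s F by blast
    qed
  next
    fix U assume U: "openin M.mtopology U"
    show "openin (seminorm_topology V P) U"
      unfolding openin_seminorm_topology
    proof (intro conjI ballI)
      show UV: "U \<subseteq> V" using U by (simp add: M.openin_mtopology)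
      fix x assume "x \<in> U"
      then obtain r where r: "r > 0" "M.mball x r \<subseteq> U"
        using U by (auto simp: M.openin_mtopology)
      have x: "x \<in> V" using \<open>x \<in> U\<close> UV by auto
      obtain N where N: "(1/2::real)^N < r" using real_arch_pow_inv[of r "1/2"] r by auto
      have "box (p ` {..<N}) (r / 2) x \<subseteq> M.mball x r"
      proof
        fix y assume "y \<in> box (p ` {..<N}) (r / 2) x"
        then have y: "y \<in> V" "\<And>n. n < N \<Longrightarrow> p n (y - x) < r / 2" by (auto simp: box_def)
        have "g x y n \<le> max (r / 2) ((1/2)^N)" for n
        proof (cases "n < N")
          case True
          have "p n (x - y) \<ge> 0" using seminorm_nonneg[OF p] x y by auto
          then have "g x y n \<le> r / 2"
            using y(2)[OF True] seminorm_diff_commute[OF p x y(1)] by (simp add: g_def)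
          then show ?thesis by simp
        next
          case False
          then have "(1/2::real)^n \<le> (1/2)^N" by (intro power_decreasing) auto
          then show ?thesis by (auto simp: g_def min_le_iff_disj le_max_iff_disj)
        qed
        then have "d x y \<le> max (r / 2) ((1/2)^N)" by (rule d_le)
        also have "\<dots> < r" using N r by auto
        finally show "y \<in> M.mball x r" using mball[OF x] y by auto
      qed
      then show "\<exists>F r. finite F \<and> F \<subseteq> P \<and> 0 < r \<and> box F r x \<subseteq> U"
        using r p by (intro exI[of _ "p ` {..<N}"] exI[of _ "r / 2"]) auto
    qed
  qed
  then show ?thesis by (metis M.metrizable_space_mtopology)
qed

end

lemma seminorm_topology_mono:
  assumes "openin (seminorm_topology V Q) U" "Q \<subseteq> P"
  shows "openin (seminorm_topology V P) U"
proof -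
  let ?B = "\<lambda>P. insert V {{y \<in> V. p (y - x) < r} | p x r. p \<in> P \<and> x \<in> V \<and> r > 0}"
  have sub: "?B Q \<subseteq> ?B P" using \<open>Q \<subseteq> P\<close> by blast
  have "generate_topology_on (?B Q) U"
    using assms(1) by (simp add: seminorm_topology_def openin_topology_generated_by_iff)
  then have "generate_topology_on (?B P) U"
  proof induction
    case Empty
    show ?case by (rule generate_topology_on.Empty)
  next
    case (Int a b)
    show ?case by (rule generate_topology_on.Int) fact+
  next
    case (UN K)
    show ?case by (rule generate_topology_on.UN) (rule UN.IH)
  next
    case (Basis s)
    then show ?case by (intro generate_topology_on.Basis subsetD[OF sub])
  qed
  then show ?thesis
    by (simp add: seminorm_topology_def openin_topology_generated_by_iff)
qed

section \<open>Sums and roots of extended nonnegative reals\<close>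

lemma summable_ennreal [simp, intro]: "(f :: 'i \<Rightarrow> ennreal) summable_on A"
  by (rule nonneg_summable_on_complete) simp

lemma infsum_ennreal_eq_SUP:
  fixes f :: "'i \<Rightarrow> ennreal"
  shows "infsum f A = (SUP F\<in>{F. finite F \<and> F \<subseteq> A}. sum f F)"
  by (rule nonneg_infsum_complete) simp

lemma sum_le_infsum_ennreal:
  fixes f :: "'i \<Rightarrow> ennreal"
  assumes "finite F" "F \<subseteq> A"
  shows "sum f F \<le> infsum f A"
  unfolding infsum_ennreal_eq_SUP using assms by (intro SUP_upper) auto

lemma le_infsum_ennreal:
  fixes f :: "'i \<Rightarrow> ennreal"
  shows "f i \<le> infsum f UNIV"
  using sum_le_infsum_ennreal[of "{i}" UNIV f] by simp

lemma infsum_mono_ennreal: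
  fixes f g :: "'i \<Rightarrow> ennreal"
  assumes "\<And>i. i \<in> A \<Longrightarrow> f i \<le> g i"
  shows "infsum f A \<le> infsum g A"
  by (rule infsum_mono) (auto simp: assms)

lemma infsum_cmult_ennreal:
  fixes f :: "'i \<Rightarrow> ennreal"
  shows "(\<Sum>\<^sub>\<infinity>i\<in>A. c * f i) = c * infsum f A"
  by (simp add: infsum_ennreal_eq_SUP SUP_mult_left_ennreal sum_distrib_left)

lemma summable_of_infsum_ennreal:
  fixes f :: "'i \<Rightarrow> complex"
  assumes "(\<Sum>\<^sub>\<infinity>i\<in>UNIV. ennreal (cmod (f i))) < top"
  shows "(\<lambda>i. cmod (f i)) summable_on UNIV" and "f summable_on UNIV"
proof -
  let ?K = "\<Sum>\<^sub>\<infinity>i\<in>UNIV. ennreal (cmod (f i))"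
  have "(\<Sum>i\<in>S. cmod (f i)) \<le> enn2real ?K" if "finite S" for S
    using enn2real_mono[OF sum_le_infsum_ennreal[OF that, of UNIV "\<lambda>i. ennreal (cmod (f i))"] assms]
    by (simp add: sum_nonneg)
  then show "(\<lambda>i. cmod (f i)) summable_on UNIV"
    by (intro nonneg_bdd_above_summable_on bdd_aboveI[of _ "enn2real ?K"]) auto
  then show "f summable_on UNIV" by (rule abs_summable_summable)
qed

lemma cmod_infsum_le_infsum_ennreal:
  fixes f :: "'i \<Rightarrow> complex"
  assumes "(\<Sum>\<^sub>\<infinity>i\<in>UNIV. ennreal (cmod (f i))) < top"
  shows "ennreal (cmod (infsum f UNIV)) \<le> (\<Sum>\<^sub>\<infinity>i\<in>UNIV. ennreal (cmod (f i)))"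
proof -
  note summable = summable_of_infsum_ennreal(1)[OF assms]
  have "ennreal (cmod (infsum f UNIV)) \<le> ennreal (\<Sum>\<^sub>\<infinity>i\<in>UNIV. cmod (f i))"
    using norm_infsum_bound[OF summable] by (rule ennreal_leI)
  also have "\<dots> = (SUP F\<in>{F. finite F \<and> F \<subseteq> UNIV}. ennreal (\<Sum>i\<in>F. cmod (f i)))"
    using summable by (rule infsum_nonneg_is_SUPREMUM_ennreal) simp
  also have "\<dots> = (\<Sum>\<^sub>\<infinity>i\<in>UNIV. ennreal (cmod (f i)))"
    unfolding infsum_ennreal_eq_SUP by simp
  finally show ?thesis .
qed

text \<open>Dominated convergence for sums, along an arbitrary filter.\<close>

lemma infsum_ennreal_tendsto_0:
  fixes f :: "'b \<Rightarrow> 'i \<Rightarrow> ennreal"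
  assumes fin: "infsum g UNIV < top" and le: "\<And>b i. f b i \<le> g i"
    and lim: "\<And>i. ((\<lambda>b. f b i) \<longlongrightarrow> 0) F"
  shows "((\<lambda>b. \<Sum>\<^sub>\<infinity>i\<in>UNIV. f b i) \<longlongrightarrow> 0) F"
proof (rule order_tendstoI)
  fix \<epsilon> :: ennreal assume \<epsilon>: "0 < \<epsilon>"
  have split: "infsum h UNIV = sum h S + infsum h (- S)" if "finite S" for h :: "'i \<Rightarrow> ennreal" and S
    using infsum_Un_disjoint[of h S "- S"] that by simp
  have "((\<lambda>S. sum g S + \<epsilon>) \<longlongrightarrow> infsum g UNIV + \<epsilon>) (finite_subsets_at_top UNIV)"
    using infsum_tendsto[of g UNIV] by (intro tendsto_add tendsto_const) auto
  moreover have "infsum g UNIV < infsum g UNIV + \<epsilon>"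
    using ennreal_add_left_cancel_less[of "infsum g UNIV" 0 \<epsilon>] fin \<epsilon> by simp
  ultimately have "eventually (\<lambda>S. infsum g UNIV < sum g S + \<epsilon>) (finite_subsets_at_top UNIV)"
    by (rule order_tendstoD)
  then obtain S where S: "finite S" "infsum g UNIV < sum g S + \<epsilon>"
    by (auto simp: eventually_finite_subsets_at_top)
  then have tail: "infsum g (- S) < \<epsilon>"
    by (metis add_left_mono leD leI split)
  have "((\<lambda>b. sum (f b) S + infsum g (- S)) \<longlongrightarrow> (\<Sum>i\<in>S. 0) + infsum g (- S)) F"
    by (intro tendsto_add tendsto_sum tendsto_const lim)
  then have "eventually (\<lambda>b. sum (f b) S + infsum g (- S) < \<epsilon>) F"
    using tail by (simp add: order_tendstoD)
  then show "eventually (\<lambda>b. infsum (f b) UNIV < \<epsilon>) F"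
  proof eventually_elim
    case (elim b)
    have "infsum (f b) UNIV \<le> sum (f b) S + infsum g (- S)"
      using le by (subst split[OF S(1)]) (intro add_left_mono infsum_mono_ennreal)
    then show ?case using elim by simp
  qed
qed simp

lemma two_mult_le_squares_ennreal: "2 * x * y \<le> x\<^sup>2 + (y::ennreal)\<^sup>2"
proof -
  have *: "2 * x * y \<le> x\<^sup>2 + y\<^sup>2" if "x \<le> y" for x y :: ennreal
  proof -
    obtain d where "y = x + d" using \<open>x \<le> y\<close> by (auto simp: le_iff_add)
    then have "x\<^sup>2 + y\<^sup>2 = 2 * x * y + d\<^sup>2"
      unfolding power2_eq_square one_add_one[symmetric]
      by (simp add: distrib_left distrib_right ac_simps del: one_add_one)
    then show ?thesis by simp
  qed
  show ?thesis
    using *[of x y] *[of y x] by (cases "x \<le> y") (auto simp: ac_simps)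
qed

lemma ennroot_le_iff:
  assumes "n > 0" "u \<ge> 0"
  shows "ennroot n x \<le> ennreal u \<longleftrightarrow> x \<le> ennreal (u ^ n)"
proof (cases x)
  case (real r)
  have "root n r \<le> u \<longleftrightarrow> root n r \<le> root n (u ^ n)"
    using assms by (simp add: real_root_power_cancel)
  then show ?thesis
    using real assms by (simp add: ennroot_def ennreal_le_iff)
qed (simp add: ennroot_def top_unique)

lemma ennroot_less_top_iff [simp]: "ennroot n x < top \<longleftrightarrow> x < top"
  by (cases x) (simp_all add: ennroot_def)

lemma ennroot_1 [simp]: "ennroot (Suc 0) x = x"
  by (cases x) (auto simp: ennroot_def)

section \<open>Powers of seminorms on formal series\<close>

text \<open>
  The functional \<open>H\<close> stands for the \<open>n\<close>-th power of a seminorm that may take the value \<open>\<infinity>\<close>. The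
  triangle inequality is expressed by convexity of \<open>H\<close> itself, because convexity is preserved under
  squaring and weighted summation. The variable \<open>G\<close> in the condition of lower semicontinuity ranges
  over all filters and not only over sequences, as completeness concerns arbitrary Cauchy filters.
\<close>

locale seminorm_power =
  fixes n :: nat and H :: "('i \<Rightarrow> complex) \<Rightarrow> ennreal"
  assumes degree_pos: "n > 0"
    and homogeneous: "H (series_scale c a) = ennreal (cmod c ^ n) * H a"
    and convex: "\<lbrakk>0 \<le> s; 0 \<le> t; s + t = 1\<rbrakk> \<Longrightarrow>
      H (series_scale (of_real s) a + series_scale (of_real t) b) \<le> ennreal s * H a + ennreal t * H b"
    and mono: "(\<And>i. cmod (a i) \<le> cmod (b i)) \<Longrightarrow> H a \<le> H b"
    and lower_semicontinuous:
      "\<lbrakk>\<And>i. ((\<lambda>a. a i) \<longlongrightarrow> l i) G; r < H l\<rbrakk> \<Longrightarrow> eventually (\<lambda>a. r < H a) G"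
    and tails_vanish: "H a < top \<Longrightarrow>
      ((\<lambda>S. H (\<lambda>i. if i \<in> S then 0 else a i)) \<longlongrightarrow> 0) (finite_subsets_at_top UNIV)"

lemma seminorm_power_coordinate:
  fixes \<gamma> :: 'i
  shows "seminorm_power (Suc 0) (\<lambda>a. ennreal (cmod (a \<gamma>)))"
proof
  fix a b :: "'i \<Rightarrow> complex" and s t :: real
  assume "0 \<le> s" "0 \<le> t" "s + t = 1"
  then show "ennreal (cmod ((series_scale (of_real s) a + series_scale (of_real t) b) \<gamma>))
      \<le> ennreal s * ennreal (cmod (a \<gamma>)) + ennreal t * ennreal (cmod (b \<gamma>))"
    using norm_triangle_ineq[of "of_real s * a \<gamma>" "of_real t * b \<gamma>"]
    by (simp add: series_scale_def norm_mult flip: ennreal_mult ennreal_plus)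
next
  fix l :: "'i \<Rightarrow> complex" and G c
  assume "\<And>i. ((\<lambda>a. a i) \<longlongrightarrow> l i) G" "c < ennreal (cmod (l \<gamma>))"
  moreover from this(1) have "((\<lambda>a. ennreal (cmod (a \<gamma>))) \<longlongrightarrow> ennreal (cmod (l \<gamma>))) G"
    by (intro tendsto_intros)
  ultimately show "eventually (\<lambda>a. c < ennreal (cmod (a \<gamma>))) G"
    by (auto intro: order_tendstoD)
next
  fix a :: "'i \<Rightarrow> complex"
  have "eventually (\<lambda>S. \<gamma> \<in> S) (finite_subsets_at_top UNIV)"
    unfolding eventually_finite_subsets_at_top by (intro exI[of _ "{\<gamma>}"]) auto
  then have "eventually (\<lambda>S. ennreal (cmod (if \<gamma> \<in> S then 0 else a \<gamma>)) = 0)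
      (finite_subsets_at_top UNIV)"
    by eventually_elim auto
  then show "((\<lambda>S. ennreal (cmod (if \<gamma> \<in> S then 0 else a \<gamma>))) \<longlongrightarrow> 0)
      (finite_subsets_at_top UNIV)"
    by (rule tendsto_eventually)
qed (auto simp: series_scale_def norm_mult ennreal_mult intro: ennreal_leI)

text \<open>
  The mixed term of the square is estimated by \<open>2xy \<le> x\<^sup>2 + y\<^sup>2\<close>, which, unlike an identity that
  involves \<open>(x - y)\<^sup>2\<close>, makes sense for infinite values.
\<close>

lemma square_convex_ennreal:
  assumes "0 \<le> s" "0 \<le> t" "s + t = (1::real)"
  shows "(ennreal s * x + ennreal t * y)\<^sup>2 \<le> ennreal s * x\<^sup>2 + ennreal t * y\<^sup>2"
proof -
  have "(ennreal s * x + ennreal t * y)\<^sup>2 =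
      (ennreal s)\<^sup>2 * x\<^sup>2 + ennreal s * ennreal t * (2 * x * y) + (ennreal t)\<^sup>2 * y\<^sup>2"
    unfolding power2_eq_square one_add_one[symmetric]
    by (simp add: distrib_left distrib_right ac_simps del: one_add_one)
  also have "\<dots> \<le> (ennreal s)\<^sup>2 * x\<^sup>2 + ennreal s * ennreal t * (x\<^sup>2 + y\<^sup>2) + (ennreal t)\<^sup>2 * y\<^sup>2"
    by (intro add_mono mult_left_mono two_mult_le_squares_ennreal) auto
  also have "\<dots> = (ennreal s + ennreal t) * (ennreal s * x\<^sup>2 + ennreal t * y\<^sup>2)"
    by (simp add: power2_eq_square algebra_simps)
  also have "ennreal s + ennreal t = 1"
    using assms by (simp flip: ennreal_plus)
  finally show ?thesis by simp
qed

text \<open>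
  This turns lower semicontinuity of \<open>h\<close> into a genuine limit below \<open>h\<close>, to which the limit laws
  for sums and products apply.
\<close>

lemma min_tendsto_of_eventually_less:
  fixes h :: "'b \<Rightarrow> 'c::linorder_topology"
  assumes "\<And>c. c < L \<Longrightarrow> eventually (\<lambda>a. c < h a) G"
  shows "((\<lambda>a. min (h a) L) \<longlongrightarrow> L) G"
proof (rule order_tendstoI)
  fix c assume "c < L"
  then show "eventually (\<lambda>a. c < min (h a) L) G" using assms[of c] by simp
qed (simp add: min_less_iff_disj)

context seminorm_power
begin

lemma truncated_tendsto:
  assumes "\<And>i. ((\<lambda>a. a i) \<longlongrightarrow> l i) G"
  shows "((\<lambda>a. min (H a) (H l)) \<longlongrightarrow> H l) G"
  by (rule min_tendsto_of_eventually_less) (rule lower_semicontinuous[OF assms])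

lemma seminorm_power_square: "seminorm_power (2 * n) (\<lambda>a. (H a)\<^sup>2)"
proof
  fix a b :: "'i \<Rightarrow> complex" and s t :: real
  assume "0 \<le> s" "0 \<le> t" "s + t = 1"
  then have "(H (series_scale (of_real s) a + series_scale (of_real t) b))\<^sup>2
      \<le> (ennreal s * H a + ennreal t * H b)\<^sup>2"
    by (intro power_mono convex) auto
  also have "\<dots> \<le> ennreal s * (H a)\<^sup>2 + ennreal t * (H b)\<^sup>2"
    by (rule square_convex_ennreal) fact+
  finally show "(H (series_scale (of_real s) a + series_scale (of_real t) b))\<^sup>2
      \<le> ennreal s * (H a)\<^sup>2 + ennreal t * (H b)\<^sup>2" .
next
  fix l G and c :: ennreal
  assume l: "\<And>i. ((\<lambda>a. a i) \<longlongrightarrow> l i) G" and c: "c < (H l)\<^sup>2"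
  have "((\<lambda>a. min (H a) (H l) * min (H a) (H l)) \<longlongrightarrow> H l * H l) G"
    using truncated_tendsto[OF l] by (intro tendsto_mult_ennreal) auto
  then have "eventually (\<lambda>a. c < min (H a) (H l) * min (H a) (H l)) G"
    using c by (simp add: order_tendstoD power2_eq_square)
  then show "eventually (\<lambda>a. c < (H a)\<^sup>2) G"
    by eventually_elim (auto simp: power2_eq_square elim!: less_le_trans intro!: mult_mono)
next
  fix a assume "(H a)\<^sup>2 < top"
  then have "((\<lambda>S. H (\<lambda>i. if i \<in> S then 0 else a i)) \<longlongrightarrow> 0) (finite_subsets_at_top UNIV)"
    by (intro tails_vanish) (auto simp: power2_eq_square ennreal_mult_less_top)
  then have "((\<lambda>S. H (\<lambda>i. if i \<in> S then 0 else a i) * H (\<lambda>i. if i \<in> S then 0 else a i))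
      \<longlongrightarrow> 0 * 0) (finite_subsets_at_top UNIV)"
    by (intro tendsto_mult_ennreal) auto
  then show "((\<lambda>S. (H (\<lambda>i. if i \<in> S then 0 else a i))\<^sup>2) \<longlongrightarrow> 0) (finite_subsets_at_top UNIV)"
    by (simp add: power2_eq_square)
qed (use degree_pos in \<open>auto simp: homogeneous mono power_mult_distrib ennreal_power
    power_even_eq mult.commute simp flip: power_mult intro!: power_mono\<close>)

end

text \<open>
  Only lower semicontinuity and the vanishing of tails need an argument. For the former it suffices
  to consider finite partial sums; a weight may be \<open>\<infinity>\<close>, where multiplication is discontinuous at 0,
  so terms that vanish at the limit point are replaced by 0. The latter is dominated convergence:
  if the sum is finite at \<open>a\<close>, then an infinite weight forces the corresponding functional to vanish
  at \<open>a\<close>, and by monotonicity also on the tails of \<open>a\<close>.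
\<close>

lemma seminorm_power_weighted_sum:
  fixes H :: "'j \<Rightarrow> ('i \<Rightarrow> complex) \<Rightarrow> ennreal"
  assumes H: "\<And>j. seminorm_power n (H j)"
  shows "seminorm_power n (\<lambda>a. \<Sum>\<^sub>\<infinity>j\<in>UNIV. K j * H j a)"
proof
  show "n > 0" using H seminorm_power.degree_pos by blast
next
  fix c a
  have "K j * H j (series_scale c a) = ennreal (cmod c ^ n) * (K j * H j a)" for j
    using seminorm_power.homogeneous[OF H, of j c a] by (simp add: mult.left_commute)
  then show "(\<Sum>\<^sub>\<infinity>j\<in>UNIV. K j * H j (series_scale c a)) =
      ennreal (cmod c ^ n) * (\<Sum>\<^sub>\<infinity>j\<in>UNIV. K j * H j a)"
    by (simp add: infsum_cmult_ennreal)
next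
  fix a b :: "'i \<Rightarrow> complex" and s t :: real
  assume st: "0 \<le> s" "0 \<le> t" "s + t = 1"
  let ?c = "series_scale (of_real s) a + series_scale (of_real t) b"
  have "(\<Sum>\<^sub>\<infinity>j\<in>UNIV. K j * H j ?c) \<le>
      (\<Sum>\<^sub>\<infinity>j\<in>UNIV. K j * (ennreal s * H j a + ennreal t * H j b))"
    using st by (intro infsum_mono_ennreal mult_left_mono seminorm_power.convex[OF H]) auto
  also have "\<dots> = ennreal s * (\<Sum>\<^sub>\<infinity>j\<in>UNIV. K j * H j a) + ennreal t * (\<Sum>\<^sub>\<infinity>j\<in>UNIV. K j * H j b)"
    by (simp add: distrib_left infsum_add mult.left_commute flip: infsum_cmult_ennreal)
  finally show "(\<Sum>\<^sub>\<infinity>j\<in>UNIV. K j * H j ?c) \<le>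
      ennreal s * (\<Sum>\<^sub>\<infinity>j\<in>UNIV. K j * H j a) + ennreal t * (\<Sum>\<^sub>\<infinity>j\<in>UNIV. K j * H j b)" .
next
  fix a b :: "'i \<Rightarrow> complex"
  assume "\<And>i. cmod (a i) \<le> cmod (b i)"
  then show "(\<Sum>\<^sub>\<infinity>j\<in>UNIV. K j * H j a) \<le> (\<Sum>\<^sub>\<infinity>j\<in>UNIV. K j * H j b)"
    by (intro infsum_mono_ennreal mult_left_mono seminorm_power.mono[OF H]) auto
next
  fix l G and c :: ennreal
  assume l: "\<And>i. ((\<lambda>a. a i) \<longlongrightarrow> l i) G" and c: "c < (\<Sum>\<^sub>\<infinity>j\<in>UNIV. K j * H j l)"
  obtain S where S: "finite S" "c < (\<Sum>j\<in>S. K j * H j l)"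
    using c by (auto simp: infsum_ennreal_eq_SUP less_SUP_iff)
  define g where "g a j = (if K j = 0 \<or> H j l = 0 then 0 else K j * min (H j a) (H j l))" for a j
  have g_le: "g a j \<le> K j * H j a" for a j
    by (auto simp: g_def intro!: mult_left_mono)
  have "((\<lambda>a. g a j) \<longlongrightarrow> K j * H j l) G" for j
  proof (cases "K j = 0 \<or> H j l = 0")
    case False
    then show ?thesis
      using seminorm_power.truncated_tendsto[OF H l]
      by (auto simp: g_def intro!: tendsto_mult_ennreal tendsto_const)
  qed (auto simp: g_def)
  then have "((\<lambda>a. \<Sum>j\<in>S. g a j) \<longlongrightarrow> (\<Sum>j\<in>S. K j * H j l)) G"
    by (intro tendsto_sum)
  then have "eventually (\<lambda>a. c < (\<Sum>j\<in>S. g a j)) G"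
    using S(2) by (rule order_tendstoD)
  then show "eventually (\<lambda>a. c < (\<Sum>\<^sub>\<infinity>j\<in>UNIV. K j * H j a)) G"
  proof eventually_elim
    case (elim a)
    note elim
    also have "(\<Sum>j\<in>S. g a j) \<le> (\<Sum>j\<in>S. K j * H j a)"
      by (intro sum_mono g_le)
    also have "\<dots> \<le> (\<Sum>\<^sub>\<infinity>j\<in>UNIV. K j * H j a)"
      using S(1) by (intro sum_le_infsum_ennreal) auto
    finally show ?case .
  qed
next
  fix a assume fin: "(\<Sum>\<^sub>\<infinity>j\<in>UNIV. K j * H j a) < top"
  let ?tail = "\<lambda>S i. if i \<in> S then 0 else a i"
  have tail_le: "H j (?tail S) \<le> H j a" for S j
    by (intro seminorm_power.mono[OF H]) auto
  show "((\<lambda>S. \<Sum>\<^sub>\<infinity>j\<in>UNIV. K j * H j (?tail S)) \<longlongrightarrow> 0) (finite_subsets_at_top UNIV)"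
  proof (rule infsum_ennreal_tendsto_0[OF fin])
    show "K j * H j (?tail S) \<le> K j * H j a" for S j
      by (intro mult_left_mono tail_le) auto
    fix j
    have "K j * H j a < top"
      using le_infsum_ennreal[of "\<lambda>j. K j * H j a" j] fin by simp
    then consider "K j = 0" | "H j a = 0" | "K j < top" "H j a < top"
      by (auto simp: ennreal_mult_less_top)
    then show "((\<lambda>S. K j * H j (?tail S)) \<longlongrightarrow> 0) (finite_subsets_at_top UNIV)"
    proof cases
      case 2
      then show ?thesis using tail_le[of j] by simp
    next
      case 3
      then have "((\<lambda>S. K j * H j (?tail S)) \<longlongrightarrow> K j * 0) (finite_subsets_at_top UNIV)"
        using tendsto_mult_ennreal[OF tendsto_const seminorm_power.tails_vanish[OF H]] by auto
      then show ?thesis by simp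
    qed simp
  qed
qed

lemma seminorm_power_hnice: "seminorm_power (2 ^ m) (hnice C m l \<gamma>)"
proof (induction m arbitrary: l \<gamma>)
  case 0
  then show ?case using seminorm_power_coordinate[of \<gamma>] by simp
next
  case (Suc m)
  let ?K = "\<lambda>\<alpha>. if even l then \<Sum>\<^sub>\<infinity>\<beta>\<in>UNIV. ennreal (cmod (C \<gamma> \<alpha> \<beta>))
    else \<Sum>\<^sub>\<infinity>\<beta>\<in>UNIV. ennreal (cmod (C \<gamma> \<beta> \<alpha>))"
  have "hnice C (Suc m) l \<gamma> = (\<lambda>a. \<Sum>\<^sub>\<infinity>\<alpha>\<in>UNIV. ?K \<alpha> * (hnice C m (l div 2) \<alpha> a)\<^sup>2)"
    by (simp add: fun_eq_iff mult.commute)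
  then show ?case
    using seminorm_power_weighted_sum[OF seminorm_power.seminorm_power_square[OF Suc]] by simp
qed

context seminorm_power
begin

lemma ennroot_le_iff_scaled:
  assumes "u > 0"
  shows "ennroot n (H a) \<le> ennreal u \<longleftrightarrow> H (series_scale (of_real (1 / u)) a) \<le> 1"
proof -
  have a: "a = series_scale (of_real u) (series_scale (of_real (1 / u)) a)"
    using assms by (simp add: series_scale_def)
  have "H a = ennreal (u ^ n) * H (series_scale (of_real (1 / u)) a)"
    using assms by (subst a, subst homogeneous) simp
  then show ?thesis
    using assms degree_pos ennreal_mult_le_mult_iff[of "ennreal (u ^ n)" _ 1]
    by (simp add: ennroot_le_iff)
qed

lemma ennroot_scale: "ennroot n (H (series_scale c a)) = ennreal (cmod c) * ennroot n (H a)"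
proof (cases "H a")
  case (real r)
  then show ?thesis
    using degree_pos homogeneous[of c a]
    by (simp add: ennroot_def real_root_mult real_root_power_cancel flip: ennreal_mult)
next
  case top
  then show ?thesis
    using degree_pos homogeneous[of c a]
    by (auto simp: ennroot_def ennreal_mult_eq_top_iff ennreal_mult_top)
qed

text \<open>
  If \<open>x\<close> and \<open>y\<close> exceed the roots at \<open>a\<close> and \<open>b\<close>, then \<open>H (a / x) \<le> 1\<close> and \<open>H (b / y) \<le> 1\<close>, and
  \<open>(a + b) / (x + y)\<close> is a convex combination of \<open>a / x\<close> and \<open>b / y\<close>. The slack \<open>\<epsilon>\<close> keeps the
  denominators positive.
\<close>

lemma ennroot_triangle: "ennroot n (H (a + b)) \<le> ennroot n (H a) + ennroot n (H b)"
proof (cases "H a = top \<or> H b = top")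
  case True
  then show ?thesis by (auto simp: ennroot_def)
next
  case False
  define u v where "u = root n (enn2real (H a))" and "v = root n (enn2real (H b))"
  have uv: "u \<ge> 0" "v \<ge> 0" "ennroot n (H a) = ennreal u" "ennroot n (H b) = ennreal v"
    using False degree_pos by (auto simp: u_def v_def ennroot_def)
  have "ennroot n (H (a + b)) \<le> ennreal (u + v + \<epsilon>)" if \<epsilon>: "\<epsilon> > 0" for \<epsilon>
  proof -
    define x y where "x = u + \<epsilon> / 2" and "y = v + \<epsilon> / 2"
    have xy: "x > 0" "y > 0" using uv \<epsilon> by (auto simp: x_def y_def add_nonneg_pos)
    have "ennroot n (H a) \<le> ennreal x" "ennroot n (H b) \<le> ennreal y"
      using uv \<epsilon> by (auto simp: x_def y_def intro!: ennreal_leI)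
    then have *: "H (series_scale (of_real (1 / x)) a) \<le> 1" "H (series_scale (of_real (1 / y)) b) \<le> 1"
      using ennroot_le_iff_scaled[OF xy(1)] ennroot_le_iff_scaled[OF xy(2)] by blast+
    have "series_scale (of_real (1 / (x + y))) (a + b) =
        series_scale (of_real (x / (x + y))) (series_scale (of_real (1 / x)) a) +
        series_scale (of_real (y / (x + y))) (series_scale (of_real (1 / y)) b)"
      using xy by (auto simp: series_scale_def fun_eq_iff distrib_left)
    moreover have st: "0 \<le> x / (x + y)" "0 \<le> y / (x + y)" "x / (x + y) + y / (x + y) = 1"
      using xy by (simp_all add: add_divide_distrib[symmetric])
    ultimately have "H (series_scale (of_real (1 / (x + y))) (a + b)) \<le>
        ennreal (x / (x + y)) * H (series_scale (of_real (1 / x)) a) +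
        ennreal (y / (x + y)) * H (series_scale (of_real (1 / y)) b)"
      using convex[OF st] by simp
    also have "\<dots> \<le> ennreal (x / (x + y)) * 1 + ennreal (y / (x + y)) * 1"
      by (intro add_mono mult_left_mono *) auto
    also have "\<dots> = 1"
      using ennreal_plus[OF st(1,2)] st(3) by simp
    finally have "ennroot n (H (a + b)) \<le> ennreal (x + y)"
      using ennroot_le_iff_scaled[of "x + y" "a + b"] xy by (metis add_pos_pos)
    moreover have "x + y = u + v + \<epsilon>" by (simp add: x_def y_def)
    ultimately show ?thesis by simp
  qed
  then have "ennroot n (H (a + b)) \<le> ennreal (u + v) + ennreal \<epsilon>" if "\<epsilon> > 0" for \<epsilon>
    using ennreal_plus[of "u + v" \<epsilon>] uv(1,2) that by simp
  then have "ennroot n (H (a + b)) \<le> ennreal (u + v)"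
    by (rule ennreal_le_epsilon)
  then show ?thesis using uv by simp
qed

end

text \<open>
  A bound by an arithmetic mean scales to a bound by a product when the right-hand sides have twice
  the degree of the left-hand side.
\<close>

lemma ennroot_bilinear_bound:
  assumes H: "seminorm_power n H" and H1: "seminorm_power (2 * n) H1" and H2: "seminorm_power (2 * n) H2"
    and B: "\<And>c d. B (series_scale c a) (series_scale d b) = series_scale (c * d) (B a b)"
    and bound: "\<And>x y. 2 * H (B x y) \<le> H1 x + H2 y"
    and fin: "H1 a < top" "H2 b < top"
  shows "ennroot n (H (B a b)) \<le> ennroot (2 * n) (H1 a) * ennroot (2 * n) (H2 b)"
proof -
  have n: "n > 0" using H by (rule seminorm_power.degree_pos)
  define u v where "u = root (2 * n) (enn2real (H1 a))" and "v = root (2 * n) (enn2real (H2 b))"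
  have uv: "u \<ge> 0" "v \<ge> 0" "ennroot (2 * n) (H1 a) = ennreal u" "ennroot (2 * n) (H2 b) = ennreal v"
    using fin n by (auto simp: u_def v_def ennroot_def)
  \<comment> \<open>The slack \<open>\<epsilon>\<close> makes the scaling factors positive.\<close>
  have le: "ennroot n (H (B a b)) \<le> ennreal ((u + \<epsilon>) * (v + \<epsilon>))" if \<epsilon>: "\<epsilon> > 0" for \<epsilon>
  proof -
    define x y where "x = u + \<epsilon>" and "y = v + \<epsilon>"
    have xy: "x > 0" "y > 0" using uv \<epsilon> by (auto simp: x_def y_def add_nonneg_pos)
    have "ennroot (2 * n) (H1 a) \<le> ennreal x" "ennroot (2 * n) (H2 b) \<le> ennreal y"
      using uv \<epsilon> by (auto simp: x_def y_def intro!: ennreal_leI)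
    then have *: "H1 (series_scale (of_real (1 / x)) a) \<le> 1" "H2 (series_scale (of_real (1 / y)) b) \<le> 1"
      using seminorm_power.ennroot_le_iff_scaled[OF H1 xy(1)]
        seminorm_power.ennroot_le_iff_scaled[OF H2 xy(2)] by blast+
    have "2 * H (series_scale (of_real (1 / (x * y))) (B a b)) \<le> 1 + 1"
      using order_trans[OF bound add_mono[OF *]] by (simp add: B)
    then have "H (series_scale (of_real (1 / (x * y))) (B a b)) \<le> 1"
      using ennreal_mult_le_mult_iff[of 2 _ 1] by simp
    then show ?thesis
      using seminorm_power.ennroot_le_iff_scaled[OF H, of "x * y" "B a b"] xy
      unfolding x_def[symmetric] y_def[symmetric] by (metis mult_pos_pos)
  qed
  have "((\<lambda>\<epsilon>. ennreal ((u + \<epsilon>) * (v + \<epsilon>))) \<longlongrightarrow> ennreal ((u + 0) * (v + 0))) (at_right 0)"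
    by (intro tendsto_intros)
  then have "ennroot n (H (B a b)) \<le> ennreal ((u + 0) * (v + 0))"
    by (rule tendsto_lowerbound) (auto simp: le eventually_at_right_less intro!: eventually_at_rightI[of _ 1])
  then show ?thesis using uv by (simp add: ennreal_mult)
qed

section \<open>The space of nice series\<close>

lemma nice_norms_cases:
  assumes "p \<in> nice_norms C W"
  obtains n H where "seminorm_power n H" "p = (\<lambda>a. ennroot n (H a))"
  using assms unfolding nice_norms_def
proof (elim UnE CollectE exE conjE)
  fix m l \<gamma> assume "p = nice_norm C m l \<gamma>"
  then show thesis
    using that[OF seminorm_power_hnice[of m C l \<gamma>]] by (simp add: nice_norm_def fun_eq_iff)
next
  fix m l w assume "p = nice_norm_fun C m l w"
  then show thesis
    using that[OF seminorm_power_weighted_sum[of _ "hnice C m l", OF seminorm_power_hnice,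
        of "\<lambda>\<gamma>. ennreal (cmod (w \<gamma>))"]]
    by (simp add: nice_norm_fun_def fun_eq_iff)
qed

lemma coordinate_in_nice_norms: "(\<lambda>a. ennreal (cmod (a i))) \<in> nice_norms C W"
proof -
  have "(\<lambda>a. ennreal (cmod (a i))) = nice_norm C 0 0 i"
    by (simp add: nice_norm_def fun_eq_iff)
  then show ?thesis unfolding nice_norms_def by force
qed

lemma nice_norm_scale:
  "p \<in> nice_norms C W \<Longrightarrow> p (series_scale c a) = ennreal (cmod c) * p a"
  by (auto elim!: nice_norms_cases simp: seminorm_power.ennroot_scale)

lemma nice_norm_triangle:
  "p \<in> nice_norms C W \<Longrightarrow> p (a + b) \<le> p a + p b"
  by (auto elim!: nice_norms_cases simp: seminorm_power.ennroot_triangle)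

lemma nice_norm_zero [simp]: "p \<in> nice_norms C W \<Longrightarrow> p 0 = 0"
  using nice_norm_scale[of p C W 0 0] by (simp add: series_scale_def zero_fun_def)

lemma nice_norm_minus: "p \<in> nice_norms C W \<Longrightarrow> p (- a) = p a"
  using nice_norm_scale[of p C W "-1" a] by (simp add: series_scale_def fun_Compl_def)

text \<open>
  Passing from \<open>H\<close> to its root turns lower semicontinuity into the statement that closed balls of a
  nice norm are closed under coefficientwise convergence.
\<close>

lemma nice_norm_lower_semicontinuous:
  assumes p: "p \<in> nice_norms C W" and lim: "\<And>i. ((\<lambda>b. f b i) \<longlongrightarrow> l i) G"
    and le: "eventually (\<lambda>b. p (f b) \<le> ennreal u) G" and G: "G \<noteq> bot" and u: "u \<ge> 0"
  shows "p l \<le> ennreal u"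
proof (rule ccontr)
  obtain n H where H: "seminorm_power n H" and p_eq: "p = (\<lambda>a. ennroot n (H a))"
    using p by (rule nice_norms_cases)
  note n = seminorm_power.degree_pos[OF H]
  assume "\<not> p l \<le> ennreal u"
  then have "ennreal (u ^ n) < H l"
    using ennroot_le_iff[OF n u] by (auto simp: p_eq)
  moreover have "\<And>i. ((\<lambda>a. a i) \<longlongrightarrow> l i) (filtermap f G)"
    using lim by (simp add: filterlim_filtermap)
  ultimately have "eventually (\<lambda>a. ennreal (u ^ n) < H a) (filtermap f G)"
    by (rule seminorm_power.lower_semicontinuous[OF H, rotated])
  then have "eventually (\<lambda>b. ennreal (u ^ n) < H (f b)) G"
    by (simp add: eventually_filtermap)
  with le have "eventually (\<lambda>b. False) G"
    by eventually_elim (use ennroot_le_iff[OF n u] in \<open>auto simp: p_eq\<close>)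
  then show False using G by simp
qed

lemma nice_norm_tails_vanish:
  assumes p: "p \<in> nice_norms C W" and fin: "p a < top" and u: "u > 0"
  shows "eventually (\<lambda>S. p (\<lambda>i. if i \<in> S then 0 else a i) \<le> ennreal u) (finite_subsets_at_top UNIV)"
proof -
  obtain n H where H: "seminorm_power n H" and p_eq: "p = (\<lambda>a. ennroot n (H a))"
    using p by (rule nice_norms_cases)
  note n = seminorm_power.degree_pos[OF H]
  have "H a < top" using fin by (simp add: p_eq)
  moreover have "0 < ennreal (u ^ n)" using u by simp
  ultimately have "eventually (\<lambda>S. H (\<lambda>i. if i \<in> S then 0 else a i) < ennreal (u ^ n))
      (finite_subsets_at_top UNIV)"
    by (rule order_tendstoD(2)[OF seminorm_power.tails_vanish[OF H]])
  then show ?thesis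
    unfolding p_eq ennroot_le_iff[OF n less_imp_le[OF u]]
    by (rule eventually_mono) (rule less_imp_le)
qed

lemma nice_series_finite:
  "a \<in> nice_series C W \<Longrightarrow> p \<in> nice_norms C W \<Longrightarrow> p a < top"
  by (simp add: nice_series_def)

lemma ennreal_nice_norm:
  "a \<in> nice_series C W \<Longrightarrow> p \<in> nice_norms C W \<Longrightarrow> ennreal (enn2real (p a)) = p a"
  using nice_series_finite[of a C W p] by simp

lemma nice_norm_less_iff:
  "a \<in> nice_series C W \<Longrightarrow> p \<in> nice_norms C W \<Longrightarrow> r > 0 \<Longrightarrow> enn2real (p a) < r \<longleftrightarrow> p a < ennreal r"
  using ennreal_nice_norm[of a C W p] ennreal_less_iff[of "enn2real (p a)" r] by simp

lemma vector_space_series_scale: "vector_space (series_scale :: complex \<Rightarrow> ('i \<Rightarrow> complex) \<Rightarrow> _)"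
  by unfold_locales (auto simp: series_scale_def fun_eq_iff algebra_simps)

interpretation series: vector_space "series_scale :: complex \<Rightarrow> ('i \<Rightarrow> complex) \<Rightarrow> _"
  by (rule vector_space_series_scale)

lemma subspace_nice_series: "series.subspace (nice_series C W)"
proof (rule series.subspaceI)
  show "0 \<in> nice_series C W" by (simp add: nice_series_def)
  show "a + b \<in> nice_series C W" if "a \<in> nice_series C W" "b \<in> nice_series C W" for a b
    unfolding nice_series_def
  proof (intro CollectI ballI)
    fix p assume p: "p \<in> nice_norms C W"
    then have "p a + p b < top" using that by (simp add: nice_series_def)
    then show "p (a + b) < top" by (rule le_less_trans[OF nice_norm_triangle[OF p]])
  qed
  show "series_scale c a \<in> nice_series C W" if "a \<in> nice_series C W" for a c
    using that by (auto simp: nice_series_def nice_norm_scale ennreal_mult_less_top)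
qed

lemma seminormed_space_nice_series:
  "seminormed_space series_scale (nice_series C W) ((\<lambda>p a. enn2real (p a)) ` nice_norms C W)"
proof (intro seminormed_space.intro vector_space_series_scale seminormed_space_axioms.intro)
  show "series.subspace (nice_series C W)" by (rule subspace_nice_series)
next
  fix q x y assume q: "q \<in> (\<lambda>p a. enn2real (p a)) ` nice_norms C W"
    and xy: "x \<in> nice_series C W" "y \<in> nice_series C W"
  then obtain p where p: "p \<in> nice_norms C W" and "q = (\<lambda>a. enn2real (p a))" by auto
  moreover have "enn2real (p (x + y)) \<le> enn2real (p x + p y)"
    using nice_norm_triangle[OF p] nice_series_finite[OF _ p] xy
    by (intro enn2real_mono) auto
  ultimately show "q (x + y) \<le> q x + q y"
    using nice_series_finite[OF _ p] xy by (simp add: enn2real_plus)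
next
  fix q c and x :: "'a \<Rightarrow> complex" assume "q \<in> (\<lambda>p a. enn2real (p a)) ` nice_norms C W"
  then show "q (series_scale c x) = cmod c * q x"
    by (auto simp: nice_norm_scale enn2real_mult)
next
  fix x :: "'a \<Rightarrow> complex"
  assume "\<And>q. q \<in> (\<lambda>p a. enn2real (p a)) ` nice_norms C W \<Longrightarrow> q x = 0"
  then have "enn2real (ennreal (cmod (x i))) = 0" for i
    using coordinate_in_nice_norms[of i C W] by blast
  then show "x = 0" by (simp add: fun_eq_iff)
qed

lemma topspace_nice_series_topology [simp]:
  "topspace (nice_series_topology C W) = nice_series C W"
  unfolding nice_series_topology_def
  by (rule seminormed_space.topspace_seminorm_topology[OF seminormed_space_nice_series])

text \<open>
  A Cauchy filter converges in each coefficient, to a series \<open>l\<close> say. By lower semicontinuity the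
  bounds \<open>p (x - y) \<le> r\<close> on a small set of the filter pass to the limit \<open>x \<rightarrow> l\<close>, so that
  \<open>l - y\<close>, and hence \<open>l\<close>, is nice and the filter converges to \<open>l\<close> in every seminorm.
\<close>

theorem complete_nice_series:
  fixes C :: "'i \<Rightarrow> 'i \<Rightarrow> 'i \<Rightarrow> complex"
  shows "complete_lcs series_scale (nice_series_topology C W)"
  unfolding complete_lcs_def
proof (intro conjI allI impI)
  interpret S: seminormed_space series_scale "nice_series C W" "(\<lambda>p a. enn2real (p a)) ` nice_norms C W"
    by (rule seminormed_space_nice_series)
  show "locally_convex_space series_scale (nice_series_topology C W)"
    unfolding nice_series_topology_def by (rule S.locally_convex_seminorm_topology)
  fix F assume F: "cauchy_filter_in (nice_series_topology C W) F"
  then have nonbot: "F \<noteq> bot" and F_V: "eventually (\<lambda>x. x \<in> nice_series C W) F"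
    by (simp_all add: cauchy_filter_in_def le_principal)
  have small: "\<exists>M. eventually (\<lambda>x. x \<in> M) F \<and>
      (\<forall>x\<in>M. \<forall>y\<in>M. x \<in> nice_series C W \<and> y \<in> nice_series C W \<and> p (x - y) < ennreal r)"
    if p: "p \<in> nice_norms C W" and r: "r > 0" for p r
  proof -
    let ?U = "{x \<in> nice_series C W. enn2real (p x) < r}"
    have "openin (nice_series_topology C W) ?U"
      unfolding nice_series_topology_def
      using S.openin_ball[OF imageI[OF p] S.V_closed(1) r] by simp
    moreover have "0 \<in> ?U" using p r by simp
    ultimately have "\<exists>M. eventually (\<lambda>x. x \<in> M) F \<and> (\<forall>x\<in>M. \<forall>y\<in>M. x - y \<in> ?U)"
      using F unfolding cauchy_filter_in_def by (elim conjE allE[of _ ?U] impE conjI)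
    then obtain M where M_F: "eventually (\<lambda>x. x \<in> M) F"
      and M: "\<forall>x\<in>M. \<forall>y\<in>M. x - y \<in> ?U" by (elim exE conjE)
    have "eventually (\<lambda>x. x \<in> M \<inter> nice_series C W) F"
      using M_F F_V by eventually_elim simp
    moreover have "p (x - y) < ennreal r" if "x \<in> M" "y \<in> M" for x y
    proof -
      have "x - y \<in> ?U" using M that by blast
      then have "x - y \<in> nice_series C W" "enn2real (p (x - y)) < r" by simp_all
      then show ?thesis using nice_norm_less_iff[OF _ p r] by simp
    qed
    ultimately show ?thesis by (intro exI[of _ "M \<inter> nice_series C W"]) simp
  qed
  have "\<exists>z. ((\<lambda>a. a i) \<longlongrightarrow> z) F" for i
  proof -
    have "cauchy_filter (filtermap (\<lambda>a. a i) F)"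
      unfolding cauchy_filter_metric_filtermap
    proof (intro allI impI)
      fix r :: real assume "r > 0"
      from small[OF coordinate_in_nice_norms[of i] this]
      show "\<exists>P. eventually P F \<and> (\<forall>x y. P x \<and> P y \<longrightarrow> dist (x i) (y i) < r)"
        by (auto simp: dist_norm ennreal_less_iff)
    qed
    then have "convergent_filter (filtermap (\<lambda>a. a i) F)"
      by (simp add: convergent_filter_iff_cauchy)
    then show ?thesis
      by (auto simp: convergent_filter_iff filterlim_def)
  qed
  then obtain l where l: "\<And>i. ((\<lambda>a. a i) \<longlongrightarrow> l i) F" by metis
  have close: "eventually (\<lambda>y. p (l - y) \<le> ennreal r) F" if p: "p \<in> nice_norms C W" and r: "r > 0" for p r
  proof -
    obtain M where M: "eventually (\<lambda>x. x \<in> M) F" "\<And>x y. x \<in> M \<Longrightarrow> y \<in> M \<Longrightarrow> p (x - y) < ennreal r"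
      using small[OF p r] by blast
    have "p (l - y) \<le> ennreal r" if "y \<in> M" for y
    proof (rule nice_norm_lower_semicontinuous[OF p _ _ nonbot])
      show "((\<lambda>x. (x - y) i) \<longlongrightarrow> (l - y) i) F" for i
        using tendsto_diff[OF l tendsto_const] by simp
      show "eventually (\<lambda>x. p (x - y) \<le> ennreal r) F"
        using M(1) by (rule eventually_mono) (rule less_imp_le[OF M(2)[OF _ that]])
    qed (use r in simp)
    with M(1) show ?thesis by (rule eventually_mono)
  qed
  have lV: "l \<in> nice_series C W"
    unfolding nice_series_def
  proof (intro CollectI ballI)
    fix p assume p: "p \<in> nice_norms C W"
    from F_V close[OF p, of 1] have "eventually (\<lambda>y. y \<in> nice_series C W \<and> p (l - y) \<le> 1) F"
      by (simp add: eventually_conj_iff)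
    then obtain y where "y \<in> nice_series C W" "p (l - y) \<le> 1"
      using nonbot eventually_happens' by blast
    moreover have "p (l - y) < top" using calculation(2) by (rule le_less_trans) simp
    ultimately have "p (l - y) + p y < top" using nice_series_finite[OF _ p, of y] by simp
    moreover have "p l \<le> p (l - y) + p y"
      using nice_norm_triangle[OF p, of "l - y" y] by simp
    ultimately show "p l < top" by (rule le_less_trans[rotated])
  qed
  have "eventually (\<lambda>y. enn2real (p (y - l)) < r) F" if p: "p \<in> nice_norms C W" and r: "r > 0" for p r
    using F_V close[OF p half_gt_zero[OF r]]
  proof (eventually_elim)
    case (elim y)
    have "y - l \<in> nice_series C W" using elim lV by auto
    moreover have "p (y - l) = p (l - y)" using nice_norm_minus[OF p, of "l - y"] by simp
    moreover have "p (l - y) < ennreal r"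
      using elim(2) by (rule le_less_trans) (use r in \<open>simp add: ennreal_less_iff\<close>)
    ultimately show ?case using nice_norm_less_iff[OF _ p r, of "y - l"] by simp
  qed
  then show "\<exists>l. limitin (nice_series_topology C W) (\<lambda>x. x) l F"
    unfolding nice_series_topology_def S.limitin_seminorm_topology using lV F_V by blast
qed

lemma sum_basis_series:
  assumes "finite S"
  shows "(\<Sum>i\<in>S. series_scale (a i) (basis_series i)) = (\<lambda>i. if i \<in> S then a i else 0)"
proof (rule ext)
  fix k
  have "(\<Sum>i\<in>S. series_scale (a i) (basis_series i)) k = (\<Sum>i\<in>S. if k = i then a i else 0)"
    using assms
  proof (induction S rule: finite_induct)
    case (insert x F)
    then show ?case by (simp add: series_scale_def basis_series_def)
  qed simp
  then show "(\<Sum>i\<in>S. series_scale (a i) (basis_series i)) k = (if k \<in> S then a k else 0)"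
    using assms by simp
qed

text \<open>
  A series minus its part supported in a finite set is a tail of the series.
\<close>

theorem nice_series_expansion:
  fixes C :: "'i \<Rightarrow> 'i \<Rightarrow> 'i \<Rightarrow> complex"
  assumes basis: "range basis_series \<subseteq> nice_series C W" and a: "a \<in> nice_series C W"
  shows "sums_unconditionally_in (nice_series_topology C W)
    (\<lambda>i. series_scale (a i) (basis_series i)) a"
proof -
  interpret S: seminormed_space series_scale "nice_series C W" "(\<lambda>p a. enn2real (p a)) ` nice_norms C W"
    by (rule seminormed_space_nice_series)
  have sum_V: "(\<Sum>i\<in>S. series_scale (a i) (basis_series i)) \<in> nice_series C W" for S
  proof (rule series.subspace_sum[OF subspace_nice_series])
    fix i
    have "basis_series i \<in> nice_series C W" using basis by blast
    then show "series_scale (a i) (basis_series i) \<in> nice_series C W" by (rule S.V_closed(3))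
  qed
  have finite_ev: "eventually finite (finite_subsets_at_top (UNIV :: 'i set))"
    by (rule eventually_finite_subsets_at_top_weakI)
  have partial: "eventually (\<lambda>S. enn2real (p ((\<Sum>i\<in>S. series_scale (a i) (basis_series i)) - a)) < r)
      (finite_subsets_at_top UNIV)" if p: "p \<in> nice_norms C W" and r: "r > 0" for p r
  proof (rule eventually_mono[OF eventually_conj[OF finite_ev
          nice_norm_tails_vanish[OF p, OF nice_series_finite[OF a p] half_gt_zero[OF r]]]])
    fix S assume S: "finite S \<and> p (\<lambda>i. if i \<in> S then 0 else a i) \<le> ennreal (r / 2)"
    have "(\<Sum>i\<in>S. series_scale (a i) (basis_series i)) - a = - (\<lambda>i. if i \<in> S then 0 else a i)"
      using conjunct1[OF S] by (simp add: sum_basis_series fun_eq_iff)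
    then have "p ((\<Sum>i\<in>S. series_scale (a i) (basis_series i)) - a) \<le> ennreal (r / 2)"
      using conjunct2[OF S] nice_norm_minus[OF p] by simp
    also have "\<dots> < ennreal r" using r by (simp add: ennreal_less_iff)
    finally show "enn2real (p ((\<Sum>i\<in>S. series_scale (a i) (basis_series i)) - a)) < r"
      using nice_norm_less_iff[OF S.V_closed(4)[OF sum_V a] p r] by simp
  qed
  show ?thesis
    unfolding sums_unconditionally_in_def nice_series_topology_def S.limitin_seminorm_topology
  proof (intro conjI ballI allI impI)
    show "a \<in> nice_series C W" by (rule a)
    show "eventually (\<lambda>S. (\<Sum>i\<in>S. series_scale (a i) (basis_series i)) \<in> nice_series C W)
        (finite_subsets_at_top UNIV)"
      by (simp add: sum_V)
    fix q and r :: real assume "q \<in> (\<lambda>p a. enn2real (p a)) ` nice_norms C W" and r: "r > 0"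
    then obtain p where p: "p \<in> nice_norms C W" and q: "q = (\<lambda>a. enn2real (p a))" by blast
    show "eventually (\<lambda>S. q ((\<Sum>i\<in>S. series_scale (a i) (basis_series i)) - a) < r)
        (finite_subsets_at_top UNIV)"
      unfolding q by (rule partial[OF p r])
  qed
qed

lemma continuous_linear_functional_dominated:
  assumes "linear_on (nice_series C W) series_scale (*) f"
    and p: "p \<in> nice_norms C W" and le: "\<And>x. x \<in> nice_series C W \<Longrightarrow> ennreal (cmod (f x)) \<le> p x"
  shows "continuous_linear_functional series_scale (nice_series_topology C W) f"
  unfolding nice_series_topology_def
proof (rule seminormed_space.continuous_linear_functional_seminorm_topology
    [OF seminormed_space_nice_series assms(1)])
  show "(\<lambda>a. enn2real (p a)) \<in> (\<lambda>p a. enn2real (p a)) ` nice_norms C W" using p by blast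
  fix x assume x: "x \<in> nice_series C W"
  then show "cmod (f x) \<le> enn2real (p x)"
    using enn2real_mono[OF le[OF x] nice_series_finite[OF x p]] by simp
qed

lemma continuous_coordinate:
  "continuous_linear_functional series_scale (nice_series_topology C W) (\<lambda>a. a i)"
  by (rule continuous_linear_functional_dominated[OF _ coordinate_in_nice_norms])
    (auto simp: linear_on_def series_scale_def)

theorem unconditional_basis_nice_series:
  assumes basis: "range basis_series \<subseteq> nice_series C W"
  shows "unconditional_schauder_basis series_scale (nice_series_topology C W)
    basis_series (\<lambda>i a. a i)"
  unfolding unconditional_schauder_basis_def
proof (intro conjI allI ballI impI)
  show "basis_series i \<in> topspace (nice_series_topology C W)" for i using basis by auto
  show "sums_unconditionally_in (nice_series_topology C W) (\<lambda>i. series_scale (a i) (basis_series i)) a"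
    if "a \<in> topspace (nice_series_topology C W)" for a
    using that by (intro nice_series_expansion[OF basis]) simp
  fix a d i
  assume "sums_unconditionally_in (nice_series_topology C W) (\<lambda>i. series_scale (d i) (basis_series i)) a"
  then have "limitin (nice_series_topology C W)
      (\<lambda>S. \<Sum>i\<in>S. series_scale (d i) (basis_series i)) a (finite_subsets_at_top UNIV)"
    by (simp add: sums_unconditionally_in_def)
  moreover have "continuous_map (nice_series_topology C W) euclidean (\<lambda>a. a i)"
    using continuous_coordinate[of C W i] by (simp add: continuous_linear_functional_def)
  ultimately have "((\<lambda>S. (\<Sum>i\<in>S. series_scale (d i) (basis_series i)) i) \<longlongrightarrow> a i)
      (finite_subsets_at_top UNIV)"
    using continuous_map_limit[of "nice_series_topology C W" euclidean "\<lambda>a. a i"] by (fastforce simp: comp_def)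
  moreover have "eventually (\<lambda>S. (\<Sum>i\<in>S. series_scale (d i) (basis_series i)) i = d i)
      (finite_subsets_at_top UNIV)"
    unfolding eventually_finite_subsets_at_top
    by (intro exI[of _ "{i}"]) (auto simp: sum_basis_series)
  then have "((\<lambda>S. (\<Sum>i\<in>S. series_scale (d i) (basis_series i)) i) \<longlongrightarrow> d i)
      (finite_subsets_at_top UNIV)"
    by (rule tendsto_eventually)
  ultimately show "d i = a i"
    by (rule tendsto_unique[OF finite_subsets_at_top_neq_bot, rotated])
qed (rule continuous_coordinate)

lemma countable_nice_norms:
  fixes C :: "'i \<Rightarrow> 'i \<Rightarrow> 'i \<Rightarrow> complex"
  assumes "countable (UNIV :: 'i set)" "countable W"
  shows "countable (nice_norms C W)"
proof -
  have "nice_norms C W \<subseteq> (\<Union>m l. range (nice_norm C m l)) \<union> (\<Union>m l. nice_norm_fun C m l ` W)"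
    unfolding nice_norms_def by blast
  moreover have "countable ((\<Union>m l. range (nice_norm C m l)) \<union> (\<Union>m l. nice_norm_fun C m l ` W))"
    using assms by (intro countable_Un countable_UN countable_image) auto
  ultimately show ?thesis by (rule countable_subset)
qed

lemma nice_norm_fun_0: "nice_norm_fun C 0 0 w a = (\<Sum>\<^sub>\<infinity>i\<in>UNIV. ennreal (cmod (w i * a i)))"
  by (simp add: nice_norm_fun_def norm_mult ennreal_mult)

text \<open>
  The series converges absolutely and is dominated by \<open>\<parallel>a\<parallel>\<^sub>0\<^sub>,\<^sub>0\<^sub>,\<^sub>\<omega> = \<Sum>\<^sub>\<gamma> |\<omega>\<^sub>\<gamma> a\<^sub>\<gamma>|\<close>.
\<close>

theorem continuous_series_functional:
  assumes "w \<in> W"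
  shows "continuous_linear_functional series_scale (nice_series_topology C W)
    (\<lambda>a. \<Sum>\<^sub>\<infinity>i\<in>UNIV. w i * a i)"
proof (rule continuous_linear_functional_dominated)
  show p: "nice_norm_fun C 0 0 w \<in> nice_norms C W"
    unfolding nice_norms_def using assms by force
  have fin: "(\<Sum>\<^sub>\<infinity>i\<in>UNIV. ennreal (cmod (w i * a i))) < top" if "a \<in> nice_series C W" for a
    using nice_series_finite[OF that p] unfolding nice_norm_fun_0 .
  show "ennreal (cmod (\<Sum>\<^sub>\<infinity>i\<in>UNIV. w i * a i)) \<le> nice_norm_fun C 0 0 w a"
    if "a \<in> nice_series C W" for a
    unfolding nice_norm_fun_0 by (rule cmod_infsum_le_infsum_ennreal[OF fin[OF that]])
  have "(\<Sum>\<^sub>\<infinity>i\<in>UNIV. w i * (a + b) i) = (\<Sum>\<^sub>\<infinity>i\<in>UNIV. w i * a i) + (\<Sum>\<^sub>\<infinity>i\<in>UNIV. w i * b i)"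
    if "a \<in> nice_series C W" "b \<in> nice_series C W" for a b
    using infsum_add[OF summable_of_infsum_ennreal(2)[OF fin[OF that(1)]]
        summable_of_infsum_ennreal(2)[OF fin[OF that(2)]]]
    by (simp add: distrib_left)
  moreover have "(\<Sum>\<^sub>\<infinity>i\<in>UNIV. w i * series_scale c a i) = c * (\<Sum>\<^sub>\<infinity>i\<in>UNIV. w i * a i)" for a c
    by (simp add: series_scale_def mult.left_commute flip: infsum_cmult_right')
  ultimately show "linear_on (nice_series C W) series_scale (*) (\<lambda>a. \<Sum>\<^sub>\<infinity>i\<in>UNIV. w i * a i)"
    by (simp add: linear_on_def)
qed

lemma infsum_basis_series: "(\<Sum>\<^sub>\<infinity>i\<in>UNIV. w i * basis_series \<alpha> i) = w \<alpha>"
proof -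
  have "(\<Sum>\<^sub>\<infinity>i\<in>UNIV. w i * basis_series \<alpha> i) = (\<Sum>\<^sub>\<infinity>i\<in>{\<alpha>}. w i * basis_series \<alpha> i)"
    by (rule infsum_cong_neutral) (auto simp: basis_series_def)
  then show ?thesis by (simp add: basis_series_def)
qed

theorem frechet_nice_series:
  fixes C :: "'i \<Rightarrow> 'i \<Rightarrow> 'i \<Rightarrow> complex"
  assumes "countable (UNIV :: 'i set)" "countable W"
  shows "frechet_space series_scale (nice_series_topology C W)"
  unfolding frechet_space_def
proof
  show "metrizable_space (nice_series_topology C W)"
    unfolding nice_series_topology_def
  proof (rule seminormed_space.metrizable_seminorm_topology[OF seminormed_space_nice_series])
    show "countable ((\<lambda>p a. enn2real (p a)) ` nice_norms C W)"
      using countable_nice_norms[OF assms] by (rule countable_image)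
    show "(\<lambda>p a. enn2real (p a)) ` nice_norms C W \<noteq> {}"
      using coordinate_in_nice_norms[of undefined C W] by auto
  qed
qed (rule complete_nice_series)

section \<open>The product of nice series\<close>

definition series_product ::
  "('i \<Rightarrow> 'i \<Rightarrow> 'i \<Rightarrow> complex) \<Rightarrow> ('i \<Rightarrow> complex) \<Rightarrow> ('i \<Rightarrow> complex) \<Rightarrow> 'i \<Rightarrow> complex" where
  "series_product C a b \<gamma> = (\<Sum>\<^sub>\<infinity>(\<alpha>, \<beta>)\<in>UNIV. C \<gamma> \<alpha> \<beta> * a \<alpha> * b \<beta>)"

text \<open>
  Since \<open>2 |a\<^sub>\<alpha> b\<^sub>\<beta>| \<le> |a\<^sub>\<alpha>|\<^sup>2 + |b\<^sub>\<beta>|\<^sup>2\<close>, a finite part of the double series is at most half of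
  \<open>\<Sum>\<^sub>\<alpha> |a\<^sub>\<alpha>|\<^sup>2 \<Sum>\<^sub>\<beta> |C\<^sub>\<alpha>\<^sub>\<beta>| + \<Sum>\<^sub>\<beta> |b\<^sub>\<beta>|\<^sup>2 \<Sum>\<^sub>\<alpha> |C\<^sub>\<alpha>\<^sub>\<beta>|\<close>, and these two sums are the functionals of
  level 1.
\<close>

lemma sum_product_terms_le:
  assumes "finite S"
  shows "2 * (\<Sum>(\<alpha>, \<beta>)\<in>S. ennreal (cmod (C \<gamma> \<alpha> \<beta> * a \<alpha> * b \<beta>)))
    \<le> hnice C 1 0 \<gamma> a + hnice C 1 1 \<gamma> b"
proof -
  define A B where "A = fst ` S" and "B = snd ` S"
  have AB: "finite A" "finite B" "S \<subseteq> A \<times> B"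
    using assms by (auto simp: A_def B_def image_iff) force+
  let ?c = "\<lambda>\<alpha> \<beta>. ennreal (cmod (C \<gamma> \<alpha> \<beta>))"
  have "2 * (\<Sum>(\<alpha>, \<beta>)\<in>S. ennreal (cmod (C \<gamma> \<alpha> \<beta> * a \<alpha> * b \<beta>))) \<le>
      2 * (\<Sum>(\<alpha>, \<beta>)\<in>A \<times> B. ennreal (cmod (C \<gamma> \<alpha> \<beta> * a \<alpha> * b \<beta>)))"
    using AB by (intro mult_left_mono sum_mono2) auto
  also have "\<dots> = (\<Sum>\<alpha>\<in>A. \<Sum>\<beta>\<in>B. ?c \<alpha> \<beta> * (2 * ennreal (cmod (a \<alpha>)) * ennreal (cmod (b \<beta>))))"
    by (simp add: sum_distrib_left norm_mult ennreal_mult ac_simps del: sum_ennreal flip: sum.cartesian_product)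
  also have "\<dots> \<le> (\<Sum>\<alpha>\<in>A. \<Sum>\<beta>\<in>B. ?c \<alpha> \<beta> * ((ennreal (cmod (a \<alpha>)))\<^sup>2 + (ennreal (cmod (b \<beta>)))\<^sup>2))"
    by (intro sum_mono mult_left_mono two_mult_le_squares_ennreal) auto
  also have "\<dots> = (\<Sum>\<alpha>\<in>A. \<Sum>\<beta>\<in>B. ?c \<alpha> \<beta> * (ennreal (cmod (a \<alpha>)))\<^sup>2) +
      (\<Sum>\<alpha>\<in>A. \<Sum>\<beta>\<in>B. ?c \<alpha> \<beta> * (ennreal (cmod (b \<beta>)))\<^sup>2)"
    by (simp add: distrib_left sum.distrib)
  also have "(\<Sum>\<alpha>\<in>A. \<Sum>\<beta>\<in>B. ?c \<alpha> \<beta> * (ennreal (cmod (a \<alpha>)))\<^sup>2) =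
      (\<Sum>\<alpha>\<in>A. (ennreal (cmod (a \<alpha>)))\<^sup>2 * (\<Sum>\<beta>\<in>B. ?c \<alpha> \<beta>))"
    by (simp only: sum_distrib_left mult.commute)
  also have "\<dots> \<le> (\<Sum>\<alpha>\<in>A. (ennreal (cmod (a \<alpha>)))\<^sup>2 * (\<Sum>\<^sub>\<infinity>\<beta>\<in>UNIV. ?c \<alpha> \<beta>))"
    using AB by (intro sum_mono mult_left_mono sum_le_infsum_ennreal) auto
  also have "\<dots> \<le> hnice C 1 0 \<gamma> a"
    using AB sum_le_infsum_ennreal[of A UNIV] by simp
  also have "(\<Sum>\<alpha>\<in>A. \<Sum>\<beta>\<in>B. ?c \<alpha> \<beta> * (ennreal (cmod (b \<beta>)))\<^sup>2) =
      (\<Sum>\<beta>\<in>B. (ennreal (cmod (b \<beta>)))\<^sup>2 * (\<Sum>\<alpha>\<in>A. ?c \<alpha> \<beta>))"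
    by (subst sum.swap) (simp only: sum_distrib_left mult.commute)
  also have "\<dots> \<le> (\<Sum>\<beta>\<in>B. (ennreal (cmod (b \<beta>)))\<^sup>2 * (\<Sum>\<^sub>\<infinity>\<alpha>\<in>UNIV. ?c \<alpha> \<beta>))"
    using AB by (intro sum_mono mult_left_mono sum_le_infsum_ennreal) auto
  also have "\<dots> \<le> hnice C 1 1 \<gamma> b"
    using AB sum_le_infsum_ennreal[of B UNIV] by simp
  finally show ?thesis by (simp add: add_mono)
qed

lemma infsum_product_terms_le:
  "2 * (\<Sum>\<^sub>\<infinity>x\<in>UNIV. ennreal (cmod (case x of (\<alpha>, \<beta>) \<Rightarrow> C \<gamma> \<alpha> \<beta> * a \<alpha> * b \<beta>)))
    \<le> hnice C 1 0 \<gamma> a + hnice C 1 1 \<gamma> b"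
  unfolding infsum_ennreal_eq_SUP SUP_mult_left_ennreal
  using sum_product_terms_le[of _ C \<gamma> a b] by (intro SUP_least) (simp add: case_prod_unfold)

lemma infsum_product_terms_finite:
  assumes "hnice C 1 0 \<gamma> a < top" "hnice C 1 1 \<gamma> b < top"
  shows "(\<Sum>\<^sub>\<infinity>x\<in>UNIV. ennreal (cmod (case x of (\<alpha>, \<beta>) \<Rightarrow> C \<gamma> \<alpha> \<beta> * a \<alpha> * b \<beta>))) < top"
    (is "?S < top")
proof -
  have "hnice C 1 0 \<gamma> a + hnice C 1 1 \<gamma> b < top" using assms by (simp del: hnice.simps)
  with infsum_product_terms_le have "2 * ?S < top" by (rule le_less_trans)
  then show ?thesis by (auto simp: ennreal_mult_less_top)
qed

text \<open>
  If the right-hand side is infinite the estimate is trivial, so it holds for all series, including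
  those for which the double series diverges and the product is a default value. This spares the
  induction below any side conditions on \<open>a\<close> and \<open>b\<close>.
\<close>

lemma cmod_series_product_le:
  "2 * ennreal (cmod (series_product C a b \<gamma>)) \<le> hnice C 1 0 \<gamma> a + hnice C 1 1 \<gamma> b"
proof (cases "hnice C 1 0 \<gamma> a < top \<and> hnice C 1 1 \<gamma> b < top")
  case True
  have "ennreal (cmod (series_product C a b \<gamma>)) \<le>
      (\<Sum>\<^sub>\<infinity>x\<in>UNIV. ennreal (cmod (case x of (\<alpha>, \<beta>) \<Rightarrow> C \<gamma> \<alpha> \<beta> * a \<alpha> * b \<beta>)))"
    unfolding series_product_def using True
    by (intro cmod_infsum_le_infsum_ennreal infsum_product_terms_finite) auto
  then have "2 * ennreal (cmod (series_product C a b \<gamma>)) \<le>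
      2 * (\<Sum>\<^sub>\<infinity>x\<in>UNIV. ennreal (cmod (case x of (\<alpha>, \<beta>) \<Rightarrow> C \<gamma> \<alpha> \<beta> * a \<alpha> * b \<beta>)))"
    by (rule mult_left_mono) simp
  then show ?thesis using infsum_product_terms_le by (rule order_trans)
next
  case False
  then have "hnice C 1 0 \<gamma> a = top \<or> hnice C 1 1 \<gamma> b = top" by (meson less_top)
  then have "hnice C 1 0 \<gamma> a + hnice C 1 1 \<gamma> b = top" by (metis ennreal_add_eq_top)
  then show ?thesis by (metis top_greatest)
qed

lemma square_mean_ennreal:
  fixes x y z :: ennreal
  assumes "2 * x \<le> y + z"
  shows "2 * x\<^sup>2 \<le> y\<^sup>2 + z\<^sup>2"
proof -
  have "2 * (2 * x\<^sup>2) = (2 * x)\<^sup>2" by (simp add: power2_eq_square ac_simps)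
  also have "\<dots> \<le> (y + z)\<^sup>2" using assms by (rule power_mono) simp
  also have "\<dots> = y\<^sup>2 + 2 * y * z + z\<^sup>2"
    unfolding power2_eq_square one_add_one[symmetric]
    by (simp add: distrib_left distrib_right ac_simps del: one_add_one)
  also have "\<dots> \<le> y\<^sup>2 + (y\<^sup>2 + z\<^sup>2) + z\<^sup>2"
    by (intro add_mono two_mult_le_squares_ennreal) auto
  also have "\<dots> = 2 * (y\<^sup>2 + z\<^sup>2)"
    unfolding one_add_one[symmetric] by (simp add: distrib_right ac_simps del: one_add_one)
  finally have "2 * (2 * x\<^sup>2) \<le> 2 * (y\<^sup>2 + z\<^sup>2)" .
  moreover have "(2 :: ennreal) \<noteq> 0" "(2 :: ennreal) < top" by simp_all
  ultimately show ?thesis by (metis ennreal_mult_le_mult_iff top.not_eq_extremum)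
qed

text \<open>
  The index \<open>l < 2\<^sup>m\<close> records in binary which summation is used at each of the \<open>m\<close> steps, the lowest
  bit belonging to the last step. Hence \<open>l\<close> and \<open>l + 2\<^sup>m\<close>, as indices at level \<open>m + 1\<close>, put a step of
  the first and of the second kind, respectively, in front of the steps described by \<open>l\<close>.
\<close>

lemma hnice_series_product_le:
  "l < 2 ^ m \<Longrightarrow> 2 * hnice C m l \<gamma> (series_product C a b) \<le>
    hnice C (Suc m) l \<gamma> a + hnice C (Suc m) (l + 2 ^ m) \<gamma> b"
proof (induction m arbitrary: l \<gamma>)
  case 0
  then show ?case using cmod_series_product_le[of C a b \<gamma>] by simp
next
  case (Suc m)
  define k where "k = l div 2"
  define K where "K \<alpha> = (if even l then \<Sum>\<^sub>\<infinity>\<beta>\<in>UNIV. ennreal (cmod (C \<gamma> \<alpha> \<beta>))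
    else \<Sum>\<^sub>\<infinity>\<beta>\<in>UNIV. ennreal (cmod (C \<gamma> \<beta> \<alpha>)))" for \<alpha>
  have k: "k < 2 ^ m" and k': "(l + 2 ^ Suc m) div 2 = k + 2 ^ m"
    using Suc.prems by (auto simp: k_def)
  have step: "hnice C (Suc j) l \<gamma> x = (\<Sum>\<^sub>\<infinity>\<alpha>\<in>UNIV. K \<alpha> * (hnice C j k \<alpha> x)\<^sup>2)" for j x
    by (simp add: K_def k_def mult.commute)
  have step': "hnice C (Suc j) (l + 2 ^ Suc m) \<gamma> x =
      (\<Sum>\<^sub>\<infinity>\<alpha>\<in>UNIV. K \<alpha> * (hnice C j (k + 2 ^ m) \<alpha> x)\<^sup>2)" for j x
    unfolding hnice.simps(2) k' K_def by (simp add: mult.commute)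
  have "2 * hnice C (Suc m) l \<gamma> (series_product C a b) =
      (\<Sum>\<^sub>\<infinity>\<alpha>\<in>UNIV. K \<alpha> * (2 * (hnice C m k \<alpha> (series_product C a b))\<^sup>2))"
    by (simp add: step mult.left_commute del: hnice.simps flip: infsum_cmult_ennreal)
  also have "\<dots> \<le> (\<Sum>\<^sub>\<infinity>\<alpha>\<in>UNIV. K \<alpha> * ((hnice C (Suc m) k \<alpha> a)\<^sup>2 + (hnice C (Suc m) (k + 2 ^ m) \<alpha> b)\<^sup>2))"
    by (intro infsum_mono_ennreal mult_left_mono square_mean_ennreal Suc.IH k) auto
  also have "\<dots> = hnice C (Suc (Suc m)) l \<gamma> a + hnice C (Suc (Suc m)) (l + 2 ^ Suc m) \<gamma> b"
    by (simp only: step[of "Suc m"] step'[of "Suc m"] distrib_left infsum_add summable_ennreal)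
  finally show ?case .
qed

lemma series_product_scale:
  "series_product C (series_scale c a) (series_scale d b) = series_scale (c * d) (series_product C a b)"
proof
  fix \<gamma>
  have "series_product C (series_scale c a) (series_scale d b) \<gamma> =
      (\<Sum>\<^sub>\<infinity>x\<in>UNIV. (c * d) * (case x of (\<alpha>, \<beta>) \<Rightarrow> C \<gamma> \<alpha> \<beta> * a \<alpha> * b \<beta>))"
    unfolding series_product_def
    by (intro infsum_cong) (auto simp: series_scale_def)
  then show "series_product C (series_scale c a) (series_scale d b) \<gamma> =
      series_scale (c * d) (series_product C a b) \<gamma>"
    by (simp add: infsum_cmult_right' series_scale_def series_product_def)
qed

lemma nice_series_hnice_finite:
  assumes "a \<in> nice_series C W" "l < 2 ^ m"
  shows "hnice C m l \<gamma> a < top"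
proof -
  have "nice_norm C m l \<gamma> \<in> nice_norms C W" using assms(2) by (auto simp: nice_norms_def)
  from nice_series_finite[OF assms(1) this] show ?thesis
    by (simp add: nice_norm_def)
qed

lemma nice_norm_series_product_le:
  assumes p: "p \<in> nice_norms C W"
  obtains q q' where "q \<in> nice_norms C W" "q' \<in> nice_norms C W"
    "\<forall>a\<in>nice_series C W. \<forall>b\<in>nice_series C W. p (series_product C a b) \<le> q a * q' b"
  using p unfolding nice_norms_def
proof (elim UnE CollectE exE conjE)
  fix m l \<gamma> assume p: "p = nice_norm C m l \<gamma>" and l: "l < (2::nat) ^ m"
  let ?q = "nice_norm C (Suc m) l \<gamma>" and ?q' = "nice_norm C (Suc m) (l + 2 ^ m) \<gamma>"
  have l': "l < 2 ^ Suc m" "l + 2 ^ m < 2 ^ Suc m" using l by simp_all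
  then have q: "?q \<in> nice_norms C W" "?q' \<in> nice_norms C W"
    unfolding nice_norms_def by blast+
  have "p (series_product C a b) \<le> ?q a * ?q' b"
    if "a \<in> nice_series C W" "b \<in> nice_series C W" for a b
    unfolding p nice_norm_def power_Suc
  proof (rule ennroot_bilinear_bound[of _ "hnice C m l \<gamma>" "hnice C (Suc m) l \<gamma>"
        "hnice C (Suc m) (l + 2 ^ m) \<gamma>" "series_product C"])
    show "seminorm_power (2 * 2 ^ m) (hnice C (Suc m) l \<gamma>)"
      "seminorm_power (2 * 2 ^ m) (hnice C (Suc m) (l + 2 ^ m) \<gamma>)"
      using seminorm_power_hnice[of "Suc m" C] unfolding power_Suc by blast+
    show "hnice C (Suc m) l \<gamma> a < top" "hnice C (Suc m) (l + 2 ^ m) \<gamma> b < top"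
      by (rule nice_series_hnice_finite[OF that(1) l'(1)] nice_series_hnice_finite[OF that(2) l'(2)])+
  qed (rule seminorm_power_hnice series_product_scale hnice_series_product_le l)+
  with q show thesis by (intro that ballI)
next
  fix m l w assume p: "p = nice_norm_fun C m l w" and l: "l < (2::nat) ^ m" and w: "w \<in> W"
  let ?q = "nice_norm_fun C (Suc m) l w" and ?q' = "nice_norm_fun C (Suc m) (l + 2 ^ m) w"
  let ?H = "\<lambda>m l a. \<Sum>\<^sub>\<infinity>\<gamma>\<in>UNIV. ennreal (cmod (w \<gamma>)) * hnice C m l \<gamma> a"
  have "l < 2 ^ Suc m" "l + 2 ^ m < 2 ^ Suc m" using l by simp_all
  then have q: "?q \<in> nice_norms C W" "?q' \<in> nice_norms C W"
    using w unfolding nice_norms_def by blast+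
  have H: "seminorm_power (2 ^ m) (?H m l)" for m l
    by (intro seminorm_power_weighted_sum seminorm_power_hnice)
  have "p (series_product C a b) \<le> ?q a * ?q' b"
    if ab: "a \<in> nice_series C W" "b \<in> nice_series C W" for a b
    unfolding p nice_norm_fun_def power_Suc
  proof (rule ennroot_bilinear_bound[of _ "?H m l" "?H (Suc m) l" "?H (Suc m) (l + 2 ^ m)" "series_product C"])
    show "seminorm_power (2 * 2 ^ m) (?H (Suc m) l)"
      "seminorm_power (2 * 2 ^ m) (?H (Suc m) (l + 2 ^ m))"
      using H[of "Suc m"] unfolding power_Suc by blast+
    show "?H (Suc m) l a < top" "?H (Suc m) (l + 2 ^ m) b < top"
      using nice_series_finite[OF ab(1) q(1)] nice_series_finite[OF ab(2) q(2)]
      unfolding nice_norm_fun_def by (simp_all del: hnice.simps)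
    fix x y
    have "2 * ?H m l (series_product C x y) =
        (\<Sum>\<^sub>\<infinity>\<gamma>\<in>UNIV. ennreal (cmod (w \<gamma>)) * (2 * hnice C m l \<gamma> (series_product C x y)))"
      by (simp add: mult.left_commute del: hnice.simps flip: infsum_cmult_ennreal)
    also have "\<dots> \<le> (\<Sum>\<^sub>\<infinity>\<gamma>\<in>UNIV. ennreal (cmod (w \<gamma>)) *
        (hnice C (Suc m) l \<gamma> x + hnice C (Suc m) (l + 2 ^ m) \<gamma> y))"
      by (intro infsum_mono_ennreal mult_left_mono hnice_series_product_le l) auto
    also have "\<dots> = ?H (Suc m) l x + ?H (Suc m) (l + 2 ^ m) y"
      by (simp only: distrib_left infsum_add summable_ennreal)
    finally show "2 * ?H m l (series_product C x y) \<le> ?H (Suc m) l x + ?H (Suc m) (l + 2 ^ m) y" .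
  qed (rule H series_product_scale)+
  with q show thesis by (intro that ballI)
qed

lemma series_product_closed:
  assumes "a \<in> nice_series C W" "b \<in> nice_series C W"
  shows "series_product C a b \<in> nice_series C W"
  unfolding nice_series_def
proof (intro CollectI ballI)
  fix p assume p: "p \<in> nice_norms C W"
  obtain q q' where q: "q \<in> nice_norms C W" "q' \<in> nice_norms C W"
    and le: "\<forall>a\<in>nice_series C W. \<forall>b\<in>nice_series C W. p (series_product C a b) \<le> q a * q' b"
    by (rule nice_norm_series_product_le[OF p])
  have "q a * q' b < top"
    using nice_series_finite[OF assms(1) q(1)] nice_series_finite[OF assms(2) q(2)]
    by (simp add: ennreal_mult_less_top)
  with bspec[OF bspec[OF le assms(1)] assms(2)] show "p (series_product C a b) < top" by (rule le_less_trans)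
qed

lemma nice_series_summable:
  assumes "a \<in> nice_series C W" "b \<in> nice_series C W"
  shows "(\<lambda>(\<alpha>, \<beta>). C \<gamma> \<alpha> \<beta> * a \<alpha> * b \<beta>) summable_on UNIV"
proof (rule summable_of_infsum_ennreal(2), rule infsum_product_terms_finite)
  show "hnice C 1 0 \<gamma> a < top" "hnice C 1 1 \<gamma> b < top"
    using nice_series_hnice_finite[OF assms(1), of 0 1 \<gamma>] nice_series_hnice_finite[OF assms(2), of 1 1 \<gamma>]
    by simp_all
qed

lemma series_product_add:
  assumes "a \<in> nice_series C W" "b \<in> nice_series C W" "d \<in> nice_series C W"
  shows "series_product C a (b + d) = series_product C a b + series_product C a d" (is ?right)
    and "series_product C (b + d) a = series_product C b a + series_product C d a" (is ?left)
proof -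
  show ?right
    using infsum_add[OF nice_series_summable[OF assms(1,2)] nice_series_summable[OF assms(1,3)]]
    by (auto simp: series_product_def fun_eq_iff case_prod_unfold distrib_left)
  show ?left
    using infsum_add[OF nice_series_summable[OF assms(2,1)] nice_series_summable[OF assms(3,1)]]
    by (auto simp: series_product_def fun_eq_iff case_prod_unfold distrib_left distrib_right)
qed

lemma linear_on_series_product:
  assumes "a \<in> nice_series C W"
  shows "linear_on (nice_series C W) series_scale series_scale (\<lambda>b. series_product C a b)"
    and "linear_on (nice_series C W) series_scale series_scale (\<lambda>b. series_product C b a)"
  using assms series_product_add[OF assms]
    series_product_scale[of C 1 a] series_product_scale[of C _ _ 1 a]
  by (simp_all add: linear_on_def)

theorem locally_convex_algebra_nice_series:
  "locally_convex_algebra series_scale (nice_series_topology C W) (series_product C)"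
  unfolding locally_convex_algebra_def
proof (intro conjI ballI)
  interpret S: seminormed_space series_scale "nice_series C W" "(\<lambda>p a. enn2real (p a)) ` nice_norms C W"
    by (rule seminormed_space_nice_series)
  show "locally_convex_space series_scale (nice_series_topology C W)"
    using complete_nice_series by (auto simp: complete_lcs_def)
  show "continuous_map (prod_topology (nice_series_topology C W) (nice_series_topology C W))
      (nice_series_topology C W) (\<lambda>(x, y). series_product C x y)"
    unfolding nice_series_topology_def
  proof (rule S.continuous_map_bilinear)
    fix P assume "P \<in> (\<lambda>p a. enn2real (p a)) ` nice_norms C W"
    then obtain p where p: "p \<in> nice_norms C W" "P = (\<lambda>a. enn2real (p a))" by auto
    obtain q q' where q: "q \<in> nice_norms C W" "q' \<in> nice_norms C W"
      "\<forall>a\<in>nice_series C W. \<forall>b\<in>nice_series C W. p (series_product C a b) \<le> q a * q' b"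
      by (rule nice_norm_series_product_le[OF p(1)])
    have "P (series_product C a b) \<le> enn2real (q a) * enn2real (q' b)"
      if ab: "a \<in> nice_series C W" "b \<in> nice_series C W" for a b
      unfolding p(2) enn2real_mult[symmetric]
    proof (rule enn2real_mono)
      show "p (series_product C a b) \<le> q a * q' b" using q(3) ab by blast
      show "q a * q' b < top"
        using nice_series_finite[OF ab(1) q(1)] nice_series_finite[OF ab(2) q(2)]
        by (simp add: ennreal_mult_less_top)
    qed
    then show "\<exists>q\<in>(\<lambda>p a. enn2real (p a)) ` nice_norms C W. \<exists>q'\<in>(\<lambda>p a. enn2real (p a)) ` nice_norms C W.
        \<forall>x\<in>nice_series C W. \<forall>y\<in>nice_series C W. P (series_product C x y) \<le> q x * q' y"
      by (intro bexI[OF _ imageI[OF q(1)]] bexI[OF _ imageI[OF q(2)]] ballI)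
  qed (auto intro: linear_on_series_product series_product_closed)
qed (auto intro: linear_on_series_product)

lemma series_product_basis:
  "series_product C (basis_series \<alpha>) (basis_series \<beta>) = (\<lambda>\<gamma>. C \<gamma> \<alpha> \<beta>)"
proof
  fix \<gamma>
  have "series_product C (basis_series \<alpha>) (basis_series \<beta>) \<gamma> =
      (\<Sum>\<^sub>\<infinity>x\<in>{(\<alpha>, \<beta>)}. case x of (\<alpha>', \<beta>') \<Rightarrow>
        C \<gamma> \<alpha>' \<beta>' * basis_series \<alpha> \<alpha>' * basis_series \<beta> \<beta>')"
    unfolding series_product_def
    by (rule infsum_cong_neutral) (auto simp: basis_series_def split: if_splits)
  then show "series_product C (basis_series \<alpha>) (basis_series \<beta>) \<gamma> = C \<gamma> \<alpha> \<beta>"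
    by (simp add: basis_series_def)
qed

section \<open>The completion of an algebra with a nice basis\<close>

locale nice_algebra = vector_space smul
  for smul :: "complex \<Rightarrow> 'a::ab_group_add \<Rightarrow> 'a" +
  fixes prd :: "'a \<Rightarrow> 'a \<Rightarrow> 'a" and e :: "'i \<Rightarrow> 'a" and \<Omega> :: "('a \<Rightarrow> complex) set"
  assumes bilinear: "bilinear_product smul prd"
    and basis: "vector_space_basis smul e"
    and functionals_linear: "\<forall>\<omega>\<in>\<Omega>. Vector_Spaces.linear smul (*) \<omega>"
    and all_nice: "nice_part smul prd e \<Omega> = UNIV"
begin

abbreviation C where "C \<equiv> struct_const smul prd e"
abbreviation W where "W \<equiv> functional_coeffs e \<Omega>"
abbreviation \<phi> where "\<phi> \<equiv> coords smul e"
abbreviation norms where "norms \<equiv> (\<lambda>p a. enn2real (p a)) ` nice_norms C W"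

lemma independent_basis: "independent (range e)" and span_basis: "span (range e) = UNIV"
  and inj_basis: "inj e"
  using basis by (auto simp: vector_space_basis_def)

lemma coords_add: "\<phi> (x + y) = \<phi> x + \<phi> y"
  using representation_add[OF independent_basis, of y x]
  by (simp add: coords_def span_basis fun_eq_iff)

lemma coords_scale: "\<phi> (smul c x) = series_scale c (\<phi> x)"
  using representation_scale[OF independent_basis, of x c]
  by (simp add: coords_def series_scale_def span_basis fun_eq_iff)

lemma coords_zero: "\<phi> 0 = 0"
  using coords_scale[of 0 0] by (simp add: series_scale_def zero_fun_def)

lemma coords_diff: "\<phi> (x - y) = \<phi> x - \<phi> y"
  using coords_add[of "x - y" y] by simp

lemma coords_basis: "\<phi> (e \<alpha>) = basis_series \<alpha>"
  using inj_basis
  by (simp add: coords_def basis_series_def representation_basis[OF independent_basis]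
      fun_eq_iff inj_eq)

lemma coords_sum: "\<phi> (\<Sum>i\<in>S. f i) = (\<Sum>i\<in>S. \<phi> (f i))"
  by (induction S rule: infinite_finite_induct) (auto simp: coords_zero coords_add)

lemma inj_coords: "inj \<phi>"
proof (rule injI)
  fix x y assume "\<phi> x = \<phi> y"
  then have "\<phi> (x - y) = 0" by (simp add: coords_diff)
  then have "representation (range e) (x - y) b = 0" for b
    using representation_ne_zero[of "range e" "x - y" b] by (auto simp: coords_def fun_eq_iff)
  then have "x - y = 0"
    using sum_nonzero_representation_eq[OF independent_basis, of "x - y"] by (simp add: span_basis)
  then show "x = y" by simp
qed

lemma basis_induct:
  assumes "\<And>x y. Q x \<Longrightarrow> Q y \<Longrightarrow> Q (x + y)" "\<And>c x. Q x \<Longrightarrow> Q (smul c x)" "\<And>\<alpha>. Q (e \<alpha>)"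
  shows "Q x"
proof (rule span_induct[of x "range e" Q])
  have "Q (smul 0 (e undefined))" by (intro assms)
  then have "Q 0" by simp
  then show "subspace (Collect Q)" using assms by (auto intro!: subspaceI)
qed (use assms(3) span_basis in auto)

lemma coords_nice: "\<phi> x \<in> nice_series C W"
  using all_nice by (auto simp: nice_part_def nice_series_def)

lemma basis_series_nice: "range basis_series \<subseteq> nice_series C W"
  using coords_nice[of "e _"] by (auto simp: coords_basis)

lemma seminormed_space_algebra:
  "seminormed_space smul UNIV ((\<lambda>p x. enn2real (p (\<phi> x))) ` nice_norms C W)"
proof (intro seminormed_space.intro seminormed_space_axioms.intro)
  interpret S: seminormed_space series_scale "nice_series C W" norms
    by (rule seminormed_space_nice_series)
  show "vector_space smul" by unfold_locales
  show "subspace UNIV" by (rule subspace_UNIV)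
  fix q assume "q \<in> (\<lambda>p x. enn2real (p (\<phi> x))) ` nice_norms C W"
  then obtain p where p: "p \<in> nice_norms C W" and q: "q = (\<lambda>x. enn2real (p (\<phi> x)))" by blast
  show "q (x + y) \<le> q x + q y" for x y
    unfolding q coords_add by (rule S.triangle[OF imageI[OF p] coords_nice coords_nice])
  show "q (smul c x) = cmod c * q x" for c x
    unfolding q coords_scale by (rule S.homogeneous[OF imageI[OF p] coords_nice])
next
  interpret S: seminormed_space series_scale "nice_series C W" norms
    by (rule seminormed_space_nice_series)
  fix x assume zero: "\<And>q. q \<in> (\<lambda>p x. enn2real (p (\<phi> x))) ` nice_norms C W \<Longrightarrow> q x = 0"
  have "\<phi> x = 0"
  proof (rule S.separating[OF coords_nice])
    fix q assume "q \<in> norms"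
    then obtain p where p: "p \<in> nice_norms C W" and q: "q = (\<lambda>a. enn2real (p a))" by blast
    show "q (\<phi> x) = 0" unfolding q by (rule zero[OF imageI[OF p]])
  qed
  then show "x = 0" using injD[OF inj_coords, of x 0] by (simp add: coords_zero)
qed

lemma nice_topology_eq:
  "nice_topology smul prd e \<Omega> =
    seminorm_topology UNIV ((\<lambda>p x. enn2real (p (\<phi> x))) ` nice_norms C W)"
  by (simp add: nice_topology_def all_nice)

text \<open>
  The seminorms on the algebra are the pullbacks of those on nice series. A neighbourhood of a point
  of the algebra is therefore the trace of a neighbourhood, given by the same seminorms and radius,
  in the larger space.
\<close>

lemma embedding_coords:
  "embedding_map (nice_topology smul prd e \<Omega>) (nice_series_topology C W) \<phi>"
proof -
  let ?P = "(\<lambda>p x. enn2real (p (\<phi> x))) ` nice_norms C W"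
  interpret A: seminormed_space smul UNIV ?P
    by (rule seminormed_space_algebra)
  interpret S: seminormed_space series_scale "nice_series C W" norms
    by (rule seminormed_space_nice_series)
  let ?X = "seminorm_topology UNIV ?P"
  let ?Y = "seminorm_topology (nice_series C W) norms"
  have "continuous_map ?X ?Y \<phi>"
  proof (rule S.continuous_map_seminorm_topologyI)
    show "\<phi> \<in> topspace ?X \<rightarrow> nice_series C W" using coords_nice by blast
    fix x q and r :: real assume "q \<in> norms" and r: "r > 0"
    then obtain p where p: "p \<in> nice_norms C W" and q: "q = (\<lambda>a. enn2real (p a))" by blast
    let ?U = "{y \<in> UNIV. enn2real (p (\<phi> (y - x))) < r}"
    have "openin ?X ?U" by (rule A.openin_ball[OF imageI[OF p] UNIV_I r])
    moreover have "x \<in> ?U" using p r by (simp add: coords_zero)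
    ultimately show "\<exists>U. openin ?X U \<and> x \<in> U \<and> (\<forall>y\<in>U. q (\<phi> y - \<phi> x) < r)"
      by (intro exI[of _ ?U]) (simp add: q coords_diff)
  qed
  moreover have "openin (subtopology ?Y (range \<phi>)) (\<phi> ` U)" if U: "openin ?X U" for U
  proof (subst openin_subopen, intro ballI)
    fix a assume "a \<in> \<phi> ` U"
    then obtain x where x: "x \<in> U" "a = \<phi> x" by blast
    then obtain F r where F: "finite F" "F \<subseteq> ?P" "r > 0" "A.box F r x \<subseteq> U"
      using U unfolding A.openin_seminorm_topology by blast
    obtain G where G: "finite G" "G \<subseteq> nice_norms C W" "F = (\<lambda>p x. enn2real (p (\<phi> x))) ` G"
      using F(1,2) by (meson finite_subset_image)
    let ?B = "S.box ((\<lambda>p a. enn2real (p a)) ` G) r a"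
    have "openin ?Y ?B" "a \<in> ?B"
      using F(3) G(1,2) coords_nice[of x] x(2)
      by (auto intro!: S.openin_box S.centre_in_box)
    moreover have "?B \<inter> range \<phi> \<subseteq> \<phi> ` U"
    proof
      fix b assume "b \<in> ?B \<inter> range \<phi>"
      then obtain y where y: "b = \<phi> y" "\<phi> y \<in> ?B" by blast
      then have "y \<in> A.box F r x"
        by (simp add: A.box_def S.box_def G(3) x(2) coords_diff)
      then show "b \<in> \<phi> ` U" using F(4) y(1) by blast
    qed
    ultimately show "\<exists>T. openin (subtopology ?Y (range \<phi>)) T \<and> a \<in> T \<and> T \<subseteq> \<phi> ` U"
      using x(2) by (intro exI[of _ "?B \<inter> range \<phi>"]) (auto simp: openin_subtopology)
  qed
  ultimately have "homeomorphic_map ?X (subtopology ?Y (range \<phi>)) \<phi>"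
    using inj_coords coords_nice
    by (intro bijective_open_imp_homeomorphic_map)
      (auto simp: open_map_def continuous_map_in_subtopology)
  then show ?thesis
    by (simp add: embedding_map_def nice_topology_eq nice_series_topology_def)
qed

text \<open>
  The finite parts of the expansion of a nice series are coordinates of elements of the algebra.
\<close>

lemma dense_coords: "nice_series_topology C W closure_of range \<phi> = nice_series C W"
proof
  show "nice_series_topology C W closure_of range \<phi> \<subseteq> nice_series C W"
    using closure_of_subset_topspace[of "nice_series_topology C W"] by simp
  show "nice_series C W \<subseteq> nice_series_topology C W closure_of range \<phi>"
  proof
    fix a assume a: "a \<in> nice_series C W"
    have "\<exists>b\<in>range \<phi>. b \<in> U" if U: "openin (nice_series_topology C W) U" "a \<in> U" for U
    proof -
      have "eventually (\<lambda>S. (\<Sum>i\<in>S. series_scale (a i) (basis_series i)) \<in> U)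
          (finite_subsets_at_top UNIV)"
        using nice_series_expansion[OF basis_series_nice a] U
        by (simp add: sums_unconditionally_in_def limitin_def)
      then obtain S where "(\<Sum>i\<in>S. series_scale (a i) (basis_series i)) \<in> U"
        using eventually_happens'[OF finite_subsets_at_top_neq_bot] by blast
      moreover have "(\<Sum>i\<in>S. series_scale (a i) (basis_series i)) = \<phi> (\<Sum>i\<in>S. smul (a i) (e i))"
        by (simp add: coords_sum coords_scale coords_basis)
      ultimately show ?thesis by auto
    qed
    then show "a \<in> nice_series_topology C W closure_of range \<phi>"
      using a by (auto simp: in_closure_of)
  qed
qed

lemma is_completion_nice_series:
  "is_completion smul (nice_topology smul prd e \<Omega>) series_scale (nice_series_topology C W) \<phi>"
proof -
  interpret A: seminormed_space smul UNIV "(\<lambda>p x. enn2real (p (\<phi> x))) ` nice_norms C W"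
    by (rule seminormed_space_algebra)
  show ?thesis
    unfolding is_completion_def
    using A.locally_convex_seminorm_topology complete_nice_series embedding_coords dense_coords
    by (simp add: nice_topology_eq linear_on_def coords_add coords_scale)
qed

lemma prd_linear:
  "prd (x + x') y = prd x y + prd x' y" "prd (smul c x) y = smul c (prd x y)"
  "prd x (y + y') = prd x y + prd x y'" "prd x (smul c y) = smul c (prd x y)"
proof -
  have left: "module_hom smul smul (\<lambda>x. prd x y)" and right: "module_hom smul smul (\<lambda>y. prd x y)"
    using bilinear by (auto simp: bilinear_product_def intro: module_hom_linearI)
  show "prd (x + x') y = prd x y + prd x' y" "prd (smul c x) y = smul c (prd x y)"
    by (rule module_hom.add[OF left] module_hom.scale[OF left])+
  show "prd x (y + y') = prd x y + prd x y'" "prd x (smul c y) = smul c (prd x y)"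
    by (rule module_hom.add[OF right] module_hom.scale[OF right])+
qed

text \<open>
  Both sides are bilinear, and on basis vectors they agree by definition of the structure constants.
\<close>

lemma series_product_coords: "series_product C (\<phi> x) (\<phi> y) = \<phi> (prd x y)"
proof (induction x rule: basis_induct)
  case (1 x x')
  then show ?case
    using series_product_add(2)[OF coords_nice[of y] coords_nice[of x] coords_nice[of x']]
    by (simp only: prd_linear coords_add)
next
  case (2 c x)
  then show ?case
    using series_product_scale[of C c "\<phi> x" 1 "\<phi> y"] by (simp add: prd_linear coords_scale)
next
  case (3 \<alpha>)
  show ?case
  proof (induction y rule: basis_induct)
    case (1 y y')
    then show ?case
      using series_product_add(1)[OF coords_nice[of "e \<alpha>"] coords_nice[of y] coords_nice[of y']]
      by (simp only: prd_linear coords_add)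
  next
    case (2 c y)
    then show ?case
      using series_product_scale[of C 1 "\<phi> (e \<alpha>)" c "\<phi> y"] by (simp add: prd_linear coords_scale)
  next
    case (3 \<beta>)
    show ?case
      by (simp add: coords_basis series_product_basis struct_const_def)
  qed
qed

lemma functional_extension:
  assumes \<omega>: "\<omega> \<in> \<Omega>"
  shows "\<exists>f. continuous_linear_functional series_scale (nice_series_topology C W) f \<and>
    (\<forall>x. f (\<phi> x) = \<omega> x)"
proof (intro exI conjI allI)
  let ?w = "\<lambda>i. \<omega> (e i)" and ?f = "\<lambda>a. \<Sum>\<^sub>\<infinity>i\<in>UNIV. \<omega> (e i) * a i"
  have "?w \<in> W" using \<omega> by (auto simp: functional_coeffs_def)
  then show cont: "continuous_linear_functional series_scale (nice_series_topology C W) ?f"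
    by (rule continuous_series_functional)
  have "module_hom smul (*) \<omega>" using \<omega> functionals_linear by (blast intro: module_hom_linearI)
  note lin = module_hom.add[OF this] module_hom.scale[OF this]
  have f_lin: "?f (\<phi> x + \<phi> y) = ?f (\<phi> x) + ?f (\<phi> y)"
      "?f (series_scale c (\<phi> x)) = c * ?f (\<phi> x)" for x y c
    using cont coords_nice unfolding continuous_linear_functional_def linear_on_def
    by (simp_all only: topspace_nice_series_topology)
  fix x
  show "?f (\<phi> x) = \<omega> x"
  proof (induction x rule: basis_induct)
    case (1 x y)
    then show ?case using f_lin(1)[of x y] lin
      by (simp only: coords_add)
  next
    case (2 c x)
    then show ?case using f_lin(2)[of c x] lin
      by (simp only: coords_scale)
  next
    case (3 \<alpha>)
    show ?case unfolding coords_basis by (rule infsum_basis_series)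
  qed
qed

lemma nice_norms_subset:
  assumes "\<Omega>' \<subseteq> \<Omega>"
  shows "nice_norms C (functional_coeffs e \<Omega>') \<subseteq> nice_norms C W"
  using assms unfolding nice_norms_def functional_coeffs_def by blast

lemma subfamily_nice:
  assumes "\<Omega>' \<subseteq> \<Omega>"
  shows "nice_part smul prd e \<Omega>' = UNIV"
    and "openin (nice_topology smul prd e \<Omega>') U \<Longrightarrow> openin (nice_topology smul prd e \<Omega>) U"
proof -
  show nice: "nice_part smul prd e \<Omega>' = UNIV"
    using all_nice nice_norms_subset[OF assms] by (fastforce simp: nice_part_def)
  assume U: "openin (nice_topology smul prd e \<Omega>') U"
  show "openin (nice_topology smul prd e \<Omega>) U"
    using U unfolding nice_topology_def nice all_nice
    by (rule seminorm_topology_mono) (rule image_mono[OF nice_norms_subset[OF assms]])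
qed

end

theorem theorem2p10:
  fixes smul :: "complex \<Rightarrow> 'a::ab_group_add \<Rightarrow> 'a"
    and prd :: "'a \<Rightarrow> 'a \<Rightarrow> 'a"
    and e :: "'i \<Rightarrow> 'a"
    and \<Omega> :: "('a \<Rightarrow> complex) set"
  assumes "vector_space smul"
    and "bilinear_product smul prd"
    and "vector_space_basis smul e"
    and "countable (UNIV :: 'i set)" and "infinite (UNIV :: 'i set)"
    and "\<forall>\<omega>\<in>\<Omega>. Vector_Spaces.linear smul (*) \<omega>"
    and "nice_part smul prd e \<Omega> = UNIV"
  shows
    \<comment> \<open>(i)\<close>
    "(topspace (completed_topology smul prd e \<Omega>) = completed_space smul prd e \<Omega> \<and>
      is_completion smul (nice_topology smul prd e \<Omega>)
        series_scale (completed_topology smul prd e \<Omega>) (coords smul e) \<and>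
      (\<exists>prd_hat. locally_convex_algebra series_scale (completed_topology smul prd e \<Omega>) prd_hat \<and>
         (\<forall>x y. prd_hat (coords smul e x) (coords smul e y) = coords smul e (prd x y))) \<and>
      (countable \<Omega> \<longrightarrow> frechet_space series_scale (completed_topology smul prd e \<Omega>)))
     \<and> \<comment> \<open>(ii)\<close>
     ((\<forall>\<alpha>. continuous_linear_functional series_scale (completed_topology smul prd e \<Omega>)
         (\<lambda>a. a \<alpha>)) \<and>
      (\<forall>\<omega>\<in>\<Omega>. \<exists>f. continuous_linear_functional series_scale
         (completed_topology smul prd e \<Omega>) f \<and> (\<forall>x. f (coords smul e x) = \<omega> x)))
     \<and> \<comment> \<open>(iii)\<close>
     ((\<forall>\<alpha>. coords smul e (e \<alpha>) = basis_series \<alpha>) \<and>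
      unconditional_schauder_basis series_scale (completed_topology smul prd e \<Omega>)
        basis_series (\<lambda>\<alpha> a. a \<alpha>))
     \<and> \<comment> \<open>(iv)\<close>
     (\<forall>\<Omega>'\<subseteq>\<Omega>. nice_part smul prd e \<Omega>' = UNIV \<and>
        (\<forall>U. openin (nice_topology smul prd e \<Omega>') U \<longrightarrow> openin (nice_topology smul prd e \<Omega>) U))"
proof -
  interpret nice_algebra smul prd e \<Omega>
    by (intro nice_algebra.intro nice_algebra_axioms.intro assms)
  have top: "completed_topology smul prd e \<Omega> = nice_series_topology C W"
    by (simp add: completed_topology_def)
  have "frechet_space series_scale (nice_series_topology C W)" if "countable \<Omega>"
    using that by (intro frechet_nice_series[OF assms(4)]) (simp add: functional_coeffs_def)
  moreover have "\<exists>prd_hat. locally_convex_algebra series_scale (nice_series_topology C W) prd_hat \<and>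
      (\<forall>x y. prd_hat (\<phi> x) (\<phi> y) = \<phi> (prd x y))"
    using locally_convex_algebra_nice_series[of C W] series_product_coords by blast
  ultimately show ?thesis
    unfolding top
    by (intro conjI allI ballI impI)
      (simp_all add: completed_space_def is_completion_nice_series continuous_coordinate
        functional_extension coords_basis unconditional_basis_nice_series[OF basis_series_nice]
        subfamily_nice)
qed

end
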